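(* Let $\mathcal F=\mathcal F(\mathbf t)$ be a formal function of $\mathbf t=(t_0,t_1,t_2,\dots)$, $t_k\in H$, and let $\mathcal L\subset\mathcal H=H((z^{-1}))$ be the corresponding formal germ of a Lagrangian submanifold, i.e. the graph of $d\mathcal F$ under the dilaton shift $\mathbf q(z)=-\mathbf 1z+t_0+t_1z+t_2z^2+\cdots$ and the identification $\mathcal H=T^*\mathcal H_+$. Then $\mathcal F$ satisfies the equations (TRR) $\displaystyle \partial_{\alpha,k+1}\partial_{\beta,l}\partial_{\gamma,m}\mathcal F(\mathbf t)=\sum_{\mu,\nu}\partial_{\alpha,k}\partial_{\mu,0}\mathcal F(\mathbf t)\;g^{\mu\nu}\;\partial_{\nu,0}\partial_{\beta,l}\partial_{\gamma,m}\mathcal F(\mathbf t)$ for all $\alpha,\beta,\gamma$ and any $k,l,m\ge0$, (SE) $\displaystyle \partial_{1,0}\mathcal F(\mathbf t)=\tfrac12(t_0,t_0)+\sum_{n\ge0}\sum_\nu t_{n+1}^\nu\,\partial_{\nu,n}\mathcal F(\mathbf t)$, (DE) $\displaystyle \partial_{1,1}\mathcal F(\mathbf t)=\sum_{n\ge0}\sum_\nu t_n^\nu\,\partial_{\nu,n}\mathcal F(\mathbf t)-2\mathcal F(\mathbf t)$ if and only if $\mathcal L\subset\mathcal H$ has the following property: $(\star)$ $\mathcal L$ is a Lagrangian cone with the vertex at the origin and such that its tangent spaces $L$ are tangent to $\mathcal L$ exactly along $zL$.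
   Context: Setting. $H$ is a finite-dimensional vector space over $\mathbb C$ with a symmetric non-degenerate bilinear form $(\cdot,\cdot)$ and a distinguished non-zero element $\mathbf 1$. Fix a basis $\{\phi_\alpha\}$ of $H$ with $\phi_1=\mathbf 1$; put $g_{\alpha\beta}=(\phi_\alpha,\phi_\beta)$, $(g^{\alpha\beta})=(g_{\alpha\beta})^{-1}$, $t_k=\sum_\alpha t_k^\alpha\phi_\alpha$, $\partial_{\alpha,k}=\partial/\partial t_k^\alpha$. Symplectic loop space. $\mathcal H=H((z^{-1}))$ is the space of Laurent series in $1/z$ (finitely many positive powers of $z$) with coefficients in $H$, with symplectic form $\Omega(\mathbf f,\mathbf g)=\frac1{2\pi i}\oint(\mathbf f(-z),\mathbf g(z))\,dz$. The Lagrangian subspaces $\mathcal H_+=H[z]$ and $\mathcal H_-=z^{-1}H[[z^{-1}]]$ give a polarization $\mathcal H=\mathcal H_+\oplus\mathcal H_-$, which identifies $(\mathcal H,\Omega)$ symplectically with the cotangent bundle $T^*\mathcal H_+$. The germ $\mathcal L$. The formal function $\mathcal F(\mathbf t)$ near $\mathbf t=0$ is viewed as a formal function on $\mathcal H_+$ near the shifted origin $\mathbf q=-z:=-\mathbf 1z$ via $\mathbf q(z)=-z+t_0+t_1z+t_2z^2+\cdots$ (dilaton shift), and $\mathcal L=\{(\mathbf p,\mathbf q)\in T^*\mathcal H_+:\mathbf p=d_{\mathbf q}\mathcal F\}$. It is a formal germ at $\mathbf q=-z$ of a Lagrangian section of $T^*\mathcal H_+$, regarded as a formal germ of a Lagrangian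 submanifold in $(\mathcal H,\Omega)$. Meaning of $(\star)$. The last condition in $(\star)$ is interpreted as follows. First, the tangent spaces $L=T_{\mathbf f}\mathcal L$ satisfy $zL\subset L$ (and therefore $\dim L/zL=\dim\mathcal H_+/z\mathcal H_+=\dim H$). Second, $zL\subset\mathcal L$. Third, the same $L$ is the tangent space to $\mathcal L$ not only along the line of $\mathbf f$ but also at all smooth points in $zL$; this is meant to include $\mathbf f$, i.e. $L=T_{\mathbf f}\mathcal L$ implies $\mathbf f\in zL$. Equivalently: $\mathcal L$ is a cone ruled by the isotropic subspaces $zL$ varying in a $\dim H$-parametric family, with the tangent spaces along $zL$ equal to the same Lagrangian space $L$. The property is understood in the sense of formal geometry near a point $\mathbf f_0$ different from the origin (here the point of $\mathcal L$ over $\mathbf q=-z$).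
   Formalization: Since the germ depends only on dF, adding a constant to F preserves (⋆) but breaks (DE); the proved equivalence therefore adds to (⋆) the normalization ∂_{1,1}F(0) = −2F(0), i.e. (DE) at t = 0, which fixes the additive constant of F. *)

theory Defs
  imports
    "HOL-Analysis.Analysis"
    "HOL-Library.Poly_Mapping"
    "HOL-Library.Groups_Big_Fun"
begin

section \<open>Formal power series in arbitrarily many variables\<close>

text \<open>
  A monomial is a finitely supported exponent vector, so every monomial has only finitely many
  factorisations and the Cauchy product is defined even for infinitely many variables.
\<close>

typedef 'v mfps = "UNIV :: (('v \<Rightarrow>\<^sub>0 nat) \<Rightarrow> complex) set"
  morphisms mcoeff MFPS ..

setup_lifting type_definition_mfps

lemma mcoeff_MFPS [simp]: "mcoeff (MFPS f) = f"
  by (simp add: MFPS_inverse)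

lemma mfps_eqI: "(\<And>m. mcoeff f m = mcoeff g m) \<Longrightarrow> f = g"
  by (metis mcoeff_inverse ext)

definition splits :: "('v \<Rightarrow>\<^sub>0 nat) \<Rightarrow> (('v \<Rightarrow>\<^sub>0 nat) \<times> ('v \<Rightarrow>\<^sub>0 nat)) set"
  where "splits m = {(a, b). a + b = m}"

lemma finite_splits [simp]: "finite (splits m)"
proof -
  let ?A = "{a. \<exists>b. a + b = m}"
  have le: "Poly_Mapping.lookup a x \<le> Poly_Mapping.lookup m x" if "a \<in> ?A" for a x
    using that by (auto simp: lookup_add)
  let ?B = "{h. \<forall>x. (x \<in> Poly_Mapping.keys m \<longrightarrow> h x \<in> {..Max (Poly_Mapping.lookup m ` Poly_Mapping.keys m)})
      \<and> (x \<notin> Poly_Mapping.keys m \<longrightarrow> h x = 0)}"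
  have "Poly_Mapping.lookup ` ?A \<subseteq> ?B"
  proof (intro subsetI, elim imageE, intro CollectI conjI allI impI)
    fix h a x assume h: "h = Poly_Mapping.lookup a" and a: "a \<in> ?A" and x: "x \<in> Poly_Mapping.keys m"
    have "Poly_Mapping.lookup m x \<le> Max (Poly_Mapping.lookup m ` Poly_Mapping.keys m)" using x by simp
    then show "h x \<in> {..Max (Poly_Mapping.lookup m ` Poly_Mapping.keys m)}" using le[OF a, of x] h by simp
  next
    fix h a x assume h: "h = Poly_Mapping.lookup a" and a: "a \<in> ?A" and x: "x \<notin> Poly_Mapping.keys m"
    then show "h x = 0" using le[OF a, of x] by (simp add: in_keys_iff)
  qed
  moreover have "finite ?B"
    by (rule finite_set_of_finite_funs) auto
  ultimately have "finite (Poly_Mapping.lookup ` ?A)"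
    by (rule finite_subset)
  then have A: "finite ?A"
    by (rule finite_imageD) (simp add: inj_on_def lookup_inject)
  have "splits m \<subseteq> ?A \<times> ?A"
    unfolding splits_def by (auto intro: add.commute)
  then show ?thesis
    using A finite_subset by blast
qed

instantiation mfps :: (type) comm_ring_1
begin

lift_definition zero_mfps :: "'a mfps" is "\<lambda>_. 0" .
lift_definition one_mfps :: "'a mfps" is "\<lambda>m. if m = 0 then 1 else 0" .
lift_definition plus_mfps :: "'a mfps \<Rightarrow> 'a mfps \<Rightarrow> 'a mfps" is "\<lambda>f g m. f m + g m" .
lift_definition minus_mfps :: "'a mfps \<Rightarrow> 'a mfps \<Rightarrow> 'a mfps" is "\<lambda>f g m. f m - g m" .
lift_definition uminus_mfps :: "'a mfps \<Rightarrow> 'a mfps" is "\<lambda>f m. - f m" .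
lift_definition times_mfps :: "'a mfps \<Rightarrow> 'a mfps \<Rightarrow> 'a mfps"
  is "\<lambda>f g m. \<Sum>(a, b)\<in>splits m. f a * g b" .

instance
proof
  fix f g h :: "'a mfps"
  show "f + g + h = f + (g + h)" by transfer (simp add: add.assoc)
  show "f + g = g + f" by transfer (simp add: add.commute)
  show "0 + f = f" by transfer simp
  show "- f + f = 0" by transfer simp
  show "f - g = f + - g" by transfer simp
  show "f * g = g * f"
    by transfer (rule ext, rule sum.reindex_bij_witness[of _ prod.swap prod.swap],
        auto simp: splits_def add.commute mult.commute)
  show "(f + g) * h = f * h + g * h"
    by transfer (simp add: distrib_right sum.distrib case_prod_unfold)
  show "1 * f = f"
  proof (rule mfps_eqI)
    fix m
    have "mcoeff (1 * f) m = (\<Sum>x\<in>splits m. if x = (0, m) then mcoeff f m else 0)"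
      unfolding times_mfps.rep_eq one_mfps.rep_eq
      by (rule sum.cong) (auto simp: splits_def split: if_splits)
    also have "\<dots> = mcoeff f m"
      by (subst sum.delta) (simp, simp add: splits_def)
    finally show "mcoeff (1 * f) m = mcoeff f m" .
  qed
  show "(0 :: 'a mfps) \<noteq> 1"
  proof
    assume "(0 :: 'a mfps) = 1"
    then have "mcoeff (0 :: 'a mfps) 0 = mcoeff 1 0" by simp
    then show False by (simp add: zero_mfps.rep_eq one_mfps.rep_eq)
  qed
  show "f * g * h = f * (g * h)"
  proof (rule mfps_eqI)
    fix m
    have "mcoeff (f * g * h) m =
        (\<Sum>x\<in>splits m. \<Sum>y\<in>splits (fst x). mcoeff f (fst y) * mcoeff g (snd y) * mcoeff h (snd x))"
      by (simp add: times_mfps.rep_eq case_prod_unfold sum_distrib_right)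
    also have "\<dots> = (\<Sum>(x, y)\<in>Sigma (splits m) (\<lambda>x. splits (fst x)).
        mcoeff f (fst y) * mcoeff g (snd y) * mcoeff h (snd x))"
      by (subst sum.Sigma) auto
    also have "\<dots> = (\<Sum>(x, y)\<in>Sigma (splits m) (\<lambda>x. splits (snd x)).
        mcoeff f (fst x) * (mcoeff g (fst y) * mcoeff h (snd y)))"
      by (rule sum.reindex_bij_witness[of _
          "\<lambda>(x, y). ((fst x + fst y, snd y), (fst x, fst y))"
          "\<lambda>(x, y). ((fst y, snd y + snd x), (snd y, snd x))"])
        (auto simp: splits_def ac_simps)
    also have "\<dots> = (\<Sum>x\<in>splits m. \<Sum>y\<in>splits (snd x).
        mcoeff f (fst x) * (mcoeff g (fst y) * mcoeff h (snd y)))"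
      by (subst sum.Sigma) auto
    also have "\<dots> = mcoeff (f * (g * h)) m"
      by (simp add: times_mfps.rep_eq case_prod_unfold sum_distrib_left)
    finally show "mcoeff (f * g * h) m = mcoeff (f * (g * h)) m" .
  qed
qed

end

definition mconst :: "complex \<Rightarrow> 'v mfps"
  where "mconst c = MFPS (\<lambda>m. if m = 0 then c else 0)"

definition mvar :: "'v \<Rightarrow> 'v mfps"
  where "mvar i = MFPS (\<lambda>m. if m = Poly_Mapping.single i 1 then 1 else 0)"

definition pd :: "'v \<Rightarrow> 'v mfps \<Rightarrow> 'v mfps"
  where "pd i f = MFPS (\<lambda>m. of_nat (Poly_Mapping.lookup m i + 1) * mcoeff f (m + Poly_Mapping.single i 1))"

lemma pd_add_mconst:
  fixes F :: "'v mfps"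
  shows "pd x (F + mconst c) = pd x F"
proof (rule mfps_eqI)
  fix m :: "'v \<Rightarrow>\<^sub>0 nat"
  have "m + Poly_Mapping.single x 1 \<noteq> 0"
  proof
    assume "m + Poly_Mapping.single x 1 = 0"
    then have "Poly_Mapping.lookup (m + Poly_Mapping.single x 1) x = 0" by simp
    then show False by (simp add: lookup_add)
  qed
  then show "mcoeff (pd x (F + mconst c)) m = mcoeff (pd x F) m"
    by (simp add: pd_def mconst_def plus_mfps.rep_eq)
qed

text \<open>
  Infinite sums are taken coefficientwise; they are only used for families with finitely many
  nonzero contributions to each coefficient.
\<close>

definition msum :: "('i \<Rightarrow> 'v mfps) \<Rightarrow> 'v mfps"
  where "msum f = MFPS (\<lambda>m. Sum_any (\<lambda>i. mcoeff (f i) m))"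

text \<open>
  Substitution of \<open>x i\<close> for the variable \<open>i\<close>. Each coefficient is a finite sum if all \<open>x i\<close> have
  zero constant term and, for each monomial \<open>m\<close>, only finitely many \<open>x i\<close> have a nonzero
  coefficient at \<open>m\<close>.
\<close>

definition msubst :: "'u mfps \<Rightarrow> ('u \<Rightarrow> 'v mfps) \<Rightarrow> 'v mfps"
  where "msubst f x = MFPS (\<lambda>m. Sum_any (\<lambda>a. mcoeff f a * mcoeff (\<Prod>i\<in>Poly_Mapping.keys a. x i ^ Poly_Mapping.lookup a i) m))"


section \<open>The loop space\<close>

text \<open>The function \<open>f\<close> stands for the series with coefficient \<open>f i\<close> at \<open>z\<close> to the power \<open>i\<close>.\<close>

definition loop_space :: "(int \<Rightarrow> 'h::zero) set"
  where "loop_space = {f. \<exists>N. \<forall>i>N. f i = 0}"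

definition loop_monom :: "'h::zero \<Rightarrow> int \<Rightarrow> int \<Rightarrow> 'h"
  where "loop_monom h k = (\<lambda>i. if i = k then h else 0)"

definition minus_part :: "(int \<Rightarrow> 'h::zero) \<Rightarrow> int \<Rightarrow> 'h"
  where "minus_part f = (\<lambda>i. if i < 0 then f i else 0)"

text \<open>
  Formal geometry is expressed by means of formal families: power series in auxiliary parameters
  \<open>s\<close> with coefficients in the loop space, the coefficient at the monomial \<open>m\<close> being \<open>f m\<close>.
  The value of a family at \<open>s = 0\<close> is \<open>f 0\<close>. Families form a module over the power series in \<open>s\<close>.
\<close>

type_synonym ('v, 'h) family = "('v \<Rightarrow>\<^sub>0 nat) \<Rightarrow> int \<Rightarrow> 'h"

definition families :: "('v, 'h::zero) family set"
  where "families = {f. \<forall>m. f m \<in> loop_space}"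

definition zmult :: "('v, 'h) family \<Rightarrow> ('v, 'h) family"
  where "zmult f = (\<lambda>m i. f m (i - 1))"

locale pairing_space = vector_space scale
  for scale :: "complex \<Rightarrow> 'h::ab_group_add \<Rightarrow> 'h" +
  fixes pair :: "'h \<Rightarrow> 'h \<Rightarrow> complex"
    and unit :: 'h
    and \<phi> :: "'n::finite \<Rightarrow> 'h"
    and e :: 'n
  assumes pair_linear: "Vector_Spaces.linear scale (*) (pair x)"
    and pair_sym: "pair x y = pair y x"
    and pair_nondegenerate: "(\<And>y. pair x y = 0) \<Longrightarrow> x = 0"
    and unit_nonzero: "unit \<noteq> 0"
    and inj_basis: "inj \<phi>"
    and independent_basis: "independent (range \<phi>)"
    and span_basis: "span (range \<phi>) = UNIV"
    and basis_unit: "\<phi> e = unit"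
begin

definition gram :: "complex ^ 'n ^ 'n"
  where "gram = (\<chi> \<alpha> \<beta>. pair (\<phi> \<alpha>) (\<phi> \<beta>))"

subsection \<open>The equations\<close>

text \<open>The variable \<open>(\<alpha>, k)\<close> is the coordinate with upper index \<open>\<alpha>\<close> of the vector \<open>t\<close> with index \<open>k\<close>.\<close>

definition TRR :: "('n \<times> nat) mfps \<Rightarrow> bool"
  where "TRR F \<longleftrightarrow> (\<forall>\<alpha> \<beta> \<gamma> k l m.
    pd (\<alpha>, k + 1) (pd (\<beta>, l) (pd (\<gamma>, m) F)) =
    (\<Sum>\<mu>\<in>UNIV. \<Sum>\<nu>\<in>UNIV. pd (\<alpha>, k) (pd (\<mu>, 0) F) * mconst (matrix_inv gram $ \<mu> $ \<nu>)
        * pd (\<nu>, 0) (pd (\<beta>, l) (pd (\<gamma>, m) F))))"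

definition SE :: "('n \<times> nat) mfps \<Rightarrow> bool"
  where "SE F \<longleftrightarrow> pd (e, 0) F =
    mconst (1/2) * (\<Sum>\<alpha>\<in>UNIV. \<Sum>\<beta>\<in>UNIV. mconst (gram $ \<alpha> $ \<beta>) * mvar (\<alpha>, 0) * mvar (\<beta>, 0))
    + msum (\<lambda>n. \<Sum>\<nu>\<in>UNIV. mvar (\<nu>, n + 1) * pd (\<nu>, n) F)"

definition DE :: "('n \<times> nat) mfps \<Rightarrow> bool"
  where "DE F \<longleftrightarrow> pd (e, 1) F = msum (\<lambda>n. \<Sum>\<nu>\<in>UNIV. mvar (\<nu>, n) * pd (\<nu>, n) F) - 2 * F"

subsection \<open>The symplectic form\<close>

text \<open>The coefficient of the series \<open>(f(-z), g(z))\<close> at \<open>1/z\<close>.\<close>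

definition \<Omega> :: "(int \<Rightarrow> 'h) \<Rightarrow> (int \<Rightarrow> 'h) \<Rightarrow> complex"
  where "\<Omega> f g = Sum_any (\<lambda>i. (-1) powi i * pair (f i) (g (- 1 - i)))"

definition \<Omega>_family :: "('v, 'h) family \<Rightarrow> ('v, 'h) family \<Rightarrow> 'v mfps"
  where "\<Omega>_family f g = MFPS (\<lambda>m. \<Sum>(a, b)\<in>splits m. \<Omega> (f a) (g b))"

definition scale_family :: "'v mfps \<Rightarrow> ('v, 'h) family \<Rightarrow> ('v, 'h) family"
  where "scale_family c f = (\<lambda>m i. \<Sum>(a, b)\<in>splits m. scale (mcoeff c a) (f b i))"

subsection \<open>The germ and its tangent spaces\<close>

definition q_coord :: "('v, 'h) family \<Rightarrow> 'n \<times> nat \<Rightarrow> 'v mfps"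
  where "q_coord f = (\<lambda>(\<alpha>, k). MFPS (\<lambda>m. representation (range \<phi>) (f m (int k)) (\<phi> \<alpha>)))"

text \<open>Dilaton shift: \<open>t\<close> is \<open>q + z\<close>, and \<open>unit\<close> is the basis vector with index \<open>e\<close>.\<close>

definition t_coord :: "('v, 'h) family \<Rightarrow> 'n \<times> nat \<Rightarrow> 'v mfps"
  where "t_coord f = (\<lambda>x. q_coord f x + (if x = (e, 1) then 1 else 0))"

text \<open>
  The projection of \<open>f\<close> to the negative part of the polarization is the covector
  \<open>v \<mapsto> \<Omega>(minus_part f, v)\<close> on the positive part; this is its value on the basis vector
  \<open>\<phi> \<alpha>\<close> times \<open>z\<close> to the power \<open>k\<close>.
\<close>

definition p_coord :: "('v, 'h) family \<Rightarrow> 'n \<times> nat \<Rightarrow> 'v mfps"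
  where "p_coord f = (\<lambda>(\<alpha>, k). MFPS (\<lambda>m. \<Omega> (minus_part (f m)) (loop_monom (\<phi> \<alpha>) (int k))))"

text \<open>
  Formal families of points of the graph of \<open>dF\<close> whose value at \<open>s = 0\<close> lies over \<open>q = -z\<close>.
  All of them have the same value at \<open>s = 0\<close>, namely the base point of the germ.
\<close>

definition germ :: "('n \<times> nat) mfps \<Rightarrow> ('v, 'h) family set"
  where "germ F = {f \<in> families.
    (\<forall>i\<ge>0. f 0 i = loop_monom (- unit) 1 i) \<and>
    (\<forall>x. p_coord f x = msubst (pd x F) (t_coord f))}"

text \<open>The graph of the Hessian of \<open>F\<close> at the point \<open>f\<close>.\<close>

definition tangent :: "('n \<times> nat) mfps \<Rightarrow> ('v, 'h) family \<Rightarrow> ('v, 'h) family set"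
  where "tangent F f = {v \<in> families.
    \<forall>x. p_coord v x = msum (\<lambda>y. msubst (pd x (pd y F)) (t_coord f) * q_coord v y)}"

definition Lagrangian :: "('v, 'h) family set \<Rightarrow> bool"
  where "Lagrangian L \<longleftrightarrow> L = {v \<in> families. \<forall>w\<in>L. \<Omega>_family v w = 0}"

text \<open>
  The countably many parameters of the families are indexed like the coordinates on the positive
  part of the loop space, so that the tautological family of all points of the germ is among them.
  The germ lives near the base point \<open>f 0\<close>: scalars are taken near \<open>1\<close>, and points of \<open>z L\<close>
  are those whose value at \<open>s = 0\<close> is the base point. All points of the germ are smooth.
\<close>

definition Lagrangian_cone :: "('n \<times> nat) mfps \<Rightarrow> bool"
  where "Lagrangian_cone F \<longleftrightarrow> (\<forall>f \<in> (germ F :: ('n \<times> nat, 'h) family set).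
    Lagrangian (tangent F f) \<and>
    (\<forall>c. mcoeff c 0 = 1 \<longrightarrow> scale_family c f \<in> germ F))"

definition tangent_exactly_along_zL :: "('n \<times> nat) mfps \<Rightarrow> bool"
  where "tangent_exactly_along_zL F \<longleftrightarrow> (\<forall>f \<in> (germ F :: ('n \<times> nat, 'h) family set).
    zmult ` tangent F f \<subseteq> tangent F f \<and>
    (\<forall>g \<in> zmult ` tangent F f. g 0 = f 0 \<longrightarrow> g \<in> germ F \<and> tangent F g = tangent F f) \<and>
    f \<in> zmult ` tangent F f)"

text \<open>
  The germ only depends on \<open>dF\<close>, so it cannot determine the constant term of \<open>F\<close>, whereas the
  dilaton equation does: at \<open>t = 0\<close> it says the following.
\<close>

definition normalized :: "('n \<times> nat) mfps \<Rightarrow> bool"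
  where "normalized F \<longleftrightarrow> mcoeff (pd (e, 1) F) 0 = - 2 * mcoeff F 0"

lemma germ_add_mconst: "germ (F + mconst c) = germ F"
  by (simp add: germ_def pd_add_mconst)

lemma tangent_add_mconst: "tangent (F + mconst c) f = tangent F f"
  by (simp add: tangent_def pd_add_mconst)

end

end

theory Submission
  imports Defs
begin

text \<open>
  The tangent space at a point of the germ is the graph of the Hessian of \<open>F\<close>, so it is enough to
  follow the Hessian. Translating \<open>z T \<subseteq> T\<close>, \<open>f \<in> z T\<close> and the cone property into coordinates gives,
  respectively, a quadratic relation between second derivatives, the differential of the string
  equation and the differential of the dilaton equation, whereas the topological recursion relation
  says precisely that the Hessian does not change to first order along \<open>z T\<close>.

  From the geometry, the equations are read off at the tautological family, where all first-order
  statements are obtained by differentiating along complex lines; the constant of integration in the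
  string equation vanishes because the two differentials force the relevant first derivative at the
  origin to equal both a second derivative and its negative. Conversely, the quadratic relation
  follows by applying the string vector field to the recursion relation, and the infinitesimal
  constancy of the Hessian integrates along segments, coefficient by coefficient.
\<close>

section \<open>Power series in infinitely many variables: sums, substitution and derivatives\<close>

section \<open>Monomials\<close>

text \<open>In Darboux coordinates, multiplication by z raises the level of q, lowers the level of p
  with a change of sign, and sends the level-0 part of p through the inverse Gram matrix into the
  level-0 part of q. On a tangent space p = H q, so this one place where momenta become positions
  produces the quadratic term in the relation between Hessian entries and the inverse Gram matrix in
  the recursion. The obstacle is that the series have infinitely many variables, and that the germ
  has a single base point. Everything is therefore said about families, and each coefficient along a
  line x + \<tau> r is a polynomial in \<tau>; so the uniqueness of derivatives and the constancy of
  functions with zero derivative can be taken from one complex variable. The cone property follows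
  from the statement about z T: if f = z w with w in T, then c f = z (c w) is again a point of z
  T.\<close>

abbreviation lookup where "lookup \<equiv> Poly_Mapping.lookup"
abbreviation keys where "keys \<equiv> Poly_Mapping.keys"

definition unit_exp :: "'v \<Rightarrow> 'v \<Rightarrow>\<^sub>0 nat"
  where "unit_exp i = Poly_Mapping.single i 1"

lemma lookup_unit_exp: "lookup (unit_exp i) j = (if i = j then 1 else 0)"
  by (simp add: unit_exp_def lookup_single when_def)

lemma keys_unit_exp [simp]: "keys (unit_exp i) = {i}"
  by (simp add: unit_exp_def)

lemma unit_exp_neq_0 [simp]: "unit_exp i \<noteq> 0" "0 \<noteq> unit_exp i"
  by (metis keys_unit_exp keys_zero insert_not_empty)+

lemma unit_exp_eq_iff [simp]: "unit_exp i = unit_exp j \<longleftrightarrow> i = j"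
  by (metis keys_unit_exp singleton_inject)

definition mdeg :: "('v \<Rightarrow>\<^sub>0 nat) \<Rightarrow> nat"
  where "mdeg m = Sum_any (lookup m)"

lemma finite_lookup [simp]: "finite {i. lookup m i \<noteq> 0}"
  by (metis finite_keys keys.rep_eq)

lemma mdeg_add [simp]: "mdeg (a + b) = mdeg a + mdeg b"
  unfolding mdeg_def lookup_add by (rule Sum_any.distrib) simp_all

lemma mdeg_eq_0 [simp]: "mdeg m = 0 \<longleftrightarrow> m = 0"
  by (auto simp: mdeg_def fun_eq_iff intro!: poly_mapping_eqI)

lemma mdeg_0 [simp]: "mdeg 0 = 0"
  by simp

lemma mdeg_unit_exp [simp]: "mdeg (unit_exp i) = 1"
  by (simp add: mdeg_def lookup_unit_exp)

lemma lookup_le_mdeg: "lookup m i \<le> mdeg m"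
proof (cases "lookup m i = 0")
  case False
  then show ?thesis
    unfolding mdeg_def Sum_any.expand_set by (intro member_le_sum) auto
qed simp

lemma split_off_unit_exp:
  assumes "lookup m i \<noteq> 0"
  obtains m' where "m = m' + unit_exp i"
proof
  show "m = (m - unit_exp i) + unit_exp i"
    using assms by (intro poly_mapping_eqI) (auto simp: lookup_add lookup_minus lookup_unit_exp)
qed

lemma diff_add_unit_exp: "lookup a i \<noteq> 0 \<Longrightarrow> a - unit_exp i + unit_exp i = a"
  by (erule split_off_unit_exp) simp

lemma exponent_induct [case_names zero add]:
  assumes zero: "P 0" and add: "\<And>a i. P a \<Longrightarrow> P (a + unit_exp i)"
  shows "P a"
proof (induction "mdeg a" arbitrary: a)
  case 0
  then show ?case using zero by simp
next
  case (Suc n)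
  then have "a \<noteq> 0" by auto
  then obtain i where "lookup a i \<noteq> 0" by (metis lookup_zero poly_mapping_eqI)
  then obtain a' where a: "a = a' + unit_exp i" by (rule split_off_unit_exp)
  with Suc have "P a'" by simp
  then show ?case unfolding a by (rule add)
qed

lemma keys_add_exponent: "keys (a + b) = keys a \<union> keys (b :: 'v \<Rightarrow>\<^sub>0 nat)"
  by (auto simp: in_keys_iff lookup_add)

lemma mem_splits [simp]: "(a, b) \<in> splits m \<longleftrightarrow> a + b = m"
  by (simp add: splits_def)

section \<open>Coefficients\<close>

lemma mcoeff_simps [simp]:
  "mcoeff 0 m = 0"
  "mcoeff (f + g) m = mcoeff f m + mcoeff g m"
  "mcoeff (f - g) m = mcoeff f m - mcoeff g m"
  "mcoeff (- f) m = - mcoeff f m"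
  by (simp_all add: zero_mfps.rep_eq plus_mfps.rep_eq minus_mfps.rep_eq uminus_mfps.rep_eq)

lemma mcoeff_one: "mcoeff 1 m = (if m = 0 then 1 else 0)"
  by (simp add: one_mfps.rep_eq)

lemma mcoeff_sum: "mcoeff (sum f A) m = (\<Sum>i\<in>A. mcoeff (f i) m)"
  by (induction A rule: infinite_finite_induct) simp_all

lemma mcoeff_mult: "mcoeff (f * g) m = (\<Sum>(a, b)\<in>splits m. mcoeff f a * mcoeff g b)"
  by (simp add: times_mfps.rep_eq)

lemma mcoeff_mconst: "mcoeff (mconst c) m = (if m = 0 then c else 0)"
  by (simp add: mconst_def)

lemma mcoeff_mvar: "mcoeff (mvar i) m = (if m = unit_exp i then 1 else 0)"
  by (simp add: mvar_def unit_exp_def)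

lemma mcoeff_pd: "mcoeff (pd i f) m = of_nat (lookup m i + 1) * mcoeff f (m + unit_exp i)"
  by (simp add: pd_def unit_exp_def)

lemma splits_0 [simp]: "splits 0 = {(0, 0)}"
proof -
  have "a = 0 \<and> b = 0" if "a + b = 0" for a b :: "'v \<Rightarrow>\<^sub>0 nat"
    using arg_cong[OF that, of mdeg] by simp
  then show ?thesis by (auto simp: splits_def)
qed

lemma mcoeff_mult_0: "mcoeff (f * g) 0 = mcoeff f 0 * mcoeff g 0"
  by (simp add: mcoeff_mult)

lemma mcoeff_mconst_mult [simp]: "mcoeff (mconst c * f) m = c * mcoeff f m"
proof -
  have "mcoeff (mconst c * f) m = (\<Sum>p\<in>splits m. if p = (0, m) then c * mcoeff f m else 0)"
    unfolding mcoeff_mult by (rule sum.cong) (auto simp: mcoeff_mconst split: if_splits)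
  then show ?thesis by (simp add: sum.delta)
qed

lemma mcoeff_mvar_mult: "mcoeff (mvar i * f) (m + unit_exp i) = mcoeff f m"
proof -
  have "mcoeff (mvar i * f) (m + unit_exp i) =
      (\<Sum>p\<in>splits (m + unit_exp i). if p = (unit_exp i, m) then mcoeff f m else 0)"
    unfolding mcoeff_mult by (rule sum.cong) (auto simp: mcoeff_mvar add.commute split: if_splits)
  then show ?thesis by (simp add: sum.delta add.commute)
qed

lemma mcoeff_mvar_mult_eq_0: "lookup m i = 0 \<Longrightarrow> mcoeff (mvar i * f) m = 0"
  unfolding mcoeff_mult by (rule sum.neutral) (auto simp: mcoeff_mvar lookup_add lookup_unit_exp)

lemma mvar_mult_eq_0: "mvar i * f = 0 \<Longrightarrow> f = 0"
  by (rule mfps_eqI) (metis mcoeff_mvar_mult mcoeff_simps(1))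

lemma mconst_0 [simp]: "mconst 0 = 0" and mconst_1 [simp]: "mconst 1 = 1"
  by (auto intro!: mfps_eqI simp: mcoeff_mconst mcoeff_one)

section \<open>Partial derivatives\<close>

lemma pd_add: "pd i (f + g) = pd i f + pd i g"
  and pd_diff: "pd i (f - g) = pd i f - pd i g"
  and pd_0 [simp]: "pd i 0 = 0"
  by (auto intro!: mfps_eqI simp: mcoeff_pd algebra_simps)

lemma pd_sum: "pd i (sum f A) = (\<Sum>j\<in>A. pd i (f j))"
  by (induction A rule: infinite_finite_induct) (simp_all add: pd_add)

lemma pd_mconst [simp]: "pd i (mconst c) = 0"
  using pd_add_mconst[of i 0 c] by simp

lemma pd_1 [simp]: "pd i 1 = 0"
  using pd_mconst[of i 1] by simp

lemma pd_mvar: "pd i (mvar j) = (if i = j then 1 else 0)"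
proof (rule mfps_eqI)
  fix m :: "'a \<Rightarrow>\<^sub>0 nat"
  have "m = 0 \<and> i = j" if "m + unit_exp i = unit_exp j"
  proof -
    have "mdeg m + 1 = 1"
      using arg_cong[OF that, of mdeg] by (simp only: mdeg_add mdeg_unit_exp)
    then show ?thesis using that by simp
  qed
  then show "mcoeff (pd i (mvar j)) m = mcoeff (if i = j then 1 else 0) m"
    by (auto simp: mcoeff_pd mcoeff_mvar mcoeff_one)
qed

lemma pd_commute: "pd i (pd j f) = pd j (pd i f)"
  by (rule mfps_eqI) (auto simp: mcoeff_pd lookup_add lookup_unit_exp ac_simps)

text \<open>One half of the Leibniz rule. In a splitting of \<open>m + unit_exp i\<close> the
  exponent of \<open>i\<close> is shared between the factors; where the share of the first factor is
  nonzero, one \<open>i\<close> can be removed from it, which leaves a splitting of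
  \<open>m\<close>.\<close>

lemma pd_mult_aux:
  "(\<Sum>(a, b)\<in>splits (m + unit_exp i). of_nat (lookup a i) * (mcoeff f a * mcoeff g b)) =
    mcoeff (pd i f * g) m"
proof -
  have "(\<Sum>(a, b)\<in>splits (m + unit_exp i). of_nat (lookup a i) * (mcoeff f a * mcoeff g b)) =
      (\<Sum>(a, b)\<in>{p \<in> splits (m + unit_exp i). lookup (fst p) i \<noteq> 0}.
        of_nat (lookup a i) * (mcoeff f a * mcoeff g b))"
    by (rule sum.mono_neutral_right) auto
  also have "\<dots> = (\<Sum>(a, b)\<in>splits m. of_nat (lookup a i + 1) * mcoeff f (a + unit_exp i) * mcoeff g b)"
  proof (rule sum.reindex_bij_witness[of _ "\<lambda>(a, b). (a + unit_exp i, b)" "\<lambda>(a, b). (a - unit_exp i, b)"], goal_cases)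
    case (1 p)
    then show ?case by (cases p) (simp add: diff_add_unit_exp)
  next
    case (2 p)
    obtain a b where p: "p = (a, b)" by (cases p)
    with 2 have a: "a - unit_exp i + unit_exp i = a" and ab: "a + b = m + unit_exp i"
      by (simp_all add: diff_add_unit_exp)
    have "(a - unit_exp i + b) + unit_exp i = (a - unit_exp i + unit_exp i) + b"
      by (simp only: ac_simps)
    then have "a - unit_exp i + b = m"
      unfolding a ab by (rule add_right_imp_eq)
    then show ?case by (simp add: p)
  next
    case (3 p)
    then show ?case by (cases p) simp
  next
    case (4 p)
    obtain a b where p: "p = (a, b)" by (cases p)
    with 4 have "m + unit_exp i = (a + b) + unit_exp i" by simp
    also have "\<dots> = a + unit_exp i + b" by (simp only: ac_simps)
    finally have "a + unit_exp i + b = m + unit_exp i" ..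
    then show ?case by (simp add: p lookup_add lookup_unit_exp)
  next
    case (5 p)
    obtain a b where p: "p = (a, b)" by (cases p)
    with 5 have a: "a - unit_exp i + unit_exp i = a" by (simp add: diff_add_unit_exp)
    have "lookup (a - unit_exp i) i + 1 = lookup (a - unit_exp i + unit_exp i) i"
      by (simp add: lookup_add lookup_unit_exp)
    then show ?case unfolding p prod.case a mult.assoc by (simp only:)
  qed
  also have "\<dots> = mcoeff (pd i f * g) m"
    by (simp add: mcoeff_mult mcoeff_pd)
  finally show ?thesis .
qed

lemma pd_mult: "pd i (f * g) = pd i f * g + f * pd i g"
proof (rule mfps_eqI)
  fix m
  let ?T = "splits (m + unit_exp i)"
  have "mcoeff (pd i (f * g)) m = (\<Sum>(a, b)\<in>?T. of_nat (lookup m i + 1) * (mcoeff f a * mcoeff g b))"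
    by (simp add: mcoeff_pd mcoeff_mult sum_distrib_left case_prod_unfold)
  also have "\<dots> = (\<Sum>(a, b)\<in>?T. of_nat (lookup a i) * (mcoeff f a * mcoeff g b)
      + of_nat (lookup b i) * (mcoeff f a * mcoeff g b))"
  proof (intro sum.cong refl, clarify)
    fix a b assume "(a, b) \<in> ?T"
    then have "lookup m i + 1 = lookup a i + lookup b i"
      by (metis lookup_add lookup_unit_exp mem_splits)
    then show "of_nat (lookup m i + 1) * (mcoeff f a * mcoeff g b) =
        of_nat (lookup a i) * (mcoeff f a * mcoeff g b) + of_nat (lookup b i) * (mcoeff f a * mcoeff g b)"
      by (simp only: of_nat_add distrib_right)
  qed
  also have "\<dots> = (\<Sum>(a, b)\<in>?T. of_nat (lookup a i) * (mcoeff f a * mcoeff g b))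
      + (\<Sum>(a, b)\<in>?T. of_nat (lookup b i) * (mcoeff f a * mcoeff g b))"
    by (simp add: sum.distrib case_prod_unfold)
  also have "(\<Sum>(a, b)\<in>?T. of_nat (lookup b i) * (mcoeff f a * mcoeff g b)) =
      (\<Sum>(a, b)\<in>?T. of_nat (lookup a i) * (mcoeff g a * mcoeff f b))"
    by (rule sum.reindex_bij_witness[of _ prod.swap prod.swap]) (auto simp: ac_simps)
  finally show "mcoeff (pd i (f * g)) m = mcoeff (pd i f * g + f * pd i g) m"
    by (simp only: pd_mult_aux mcoeff_simps mult.commute[of "pd i g"])
qed

lemma eq_mconst_if_pd_eq_0:
  assumes "\<And>i. pd i f = 0"
  shows "f = mconst (mcoeff f 0)"
proof (rule mfps_eqI)
  fix m
  show "mcoeff f m = mcoeff (mconst (mcoeff f 0)) m"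
  proof (cases "m = 0")
    case False
    then obtain i where "lookup m i \<noteq> 0" by (metis lookup_zero poly_mapping_eqI)
    then obtain m' where "m = m' + unit_exp i" by (rule split_off_unit_exp)
    moreover have "of_nat (lookup m' i + 1) * mcoeff f (m' + unit_exp i) = 0"
      using assms[of i] by (metis mcoeff_pd mcoeff_simps(1))
    ultimately show ?thesis using False
      by (simp add: mcoeff_mconst del: of_nat_add of_nat_Suc)
  qed (simp add: mcoeff_mconst)
qed

section \<open>Locally finite sums\<close>

text \<open>\<open>Sum_any\<close> is 0 by convention on an infinite support; this condition makes
  every coefficient of \<open>msum f\<close> a genuine finite sum.\<close>

definition locfin :: "('i \<Rightarrow> 'v mfps) \<Rightarrow> bool"
  where "locfin f \<longleftrightarrow> (\<forall>m. finite {i. mcoeff (f i) m \<noteq> 0})"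

lemma locfinD: "locfin f \<Longrightarrow> finite {i. mcoeff (f i) m \<noteq> 0}"
  by (simp add: locfin_def)

lemma mcoeff_msum: "mcoeff (msum f) m = Sum_any (\<lambda>i. mcoeff (f i) m)"
  by (simp add: msum_def)

lemma mcoeff_msum_superset:
  assumes "finite K" "{i. mcoeff (f i) m \<noteq> 0} \<subseteq> K"
  shows "mcoeff (msum f) m = (\<Sum>i\<in>K. mcoeff (f i) m)"
  unfolding mcoeff_msum using assms by (rule Sum_any.expand_superset)

lemma locfin_add: "locfin f \<Longrightarrow> locfin g \<Longrightarrow> locfin (\<lambda>i. f i + g i)"
  unfolding locfin_def
proof
  fix m assume *: "\<forall>m. finite {i. mcoeff (f i) m \<noteq> 0}" "\<forall>m. finite {i. mcoeff (g i) m \<noteq> 0}"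
  show "finite {i. mcoeff (f i + g i) m \<noteq> 0}"
    by (rule finite_subset[of _ "{i. mcoeff (f i) m \<noteq> 0} \<union> {i. mcoeff (g i) m \<noteq> 0}"]) (auto simp: *)
qed

lemma locfin_minus: "locfin f \<Longrightarrow> locfin (\<lambda>i. - f i)"
  by (simp add: locfin_def)

lemma locfin_diff: "locfin f \<Longrightarrow> locfin g \<Longrightarrow> locfin (\<lambda>i. f i - g i)"
  using locfin_add[of f "\<lambda>i. - g i"] locfin_minus[of g] by simp

lemma locfin_0 [simp]: "locfin (\<lambda>i. 0)"
  by (simp add: locfin_def)

lemma locfin_sum: "(\<And>j. j \<in> J \<Longrightarrow> locfin (f j)) \<Longrightarrow> locfin (\<lambda>i. \<Sum>j\<in>J. f j i)"
  by (induction J rule: infinite_finite_induct) (auto intro!: locfin_add)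

text \<open>A coefficient of a product at \<open>m\<close> sees the second factor only at divisors
  \<open>b\<close> of \<open>m\<close>. The union of \<open>S b\<close> over them is one finite
  index set that serves all these \<open>b\<close> at once.\<close>

definition cover :: "(('v \<Rightarrow>\<^sub>0 nat) \<Rightarrow> 'i set) \<Rightarrow> ('v \<Rightarrow>\<^sub>0 nat) \<Rightarrow> 'i set"
  where "cover S m = (\<Union>b\<in>snd ` splits m. S b)"

lemma finite_cover [simp]: "(\<And>m. finite (S m)) \<Longrightarrow> finite (cover S m)"
  by (simp add: cover_def)

lemma coverI: "a + b = m \<Longrightarrow> i \<in> S b \<Longrightarrow> i \<in> cover S m"
  unfolding cover_def by (metis UN_iff imageI mem_splits snd_conv)

lemma coverE:
  assumes "i \<in> cover S m"
  obtains a b where "a + b = m" "i \<in> S b"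
  using assms by (auto simp: cover_def)

lemma cover_mono: "a + b = m \<Longrightarrow> cover S b \<subseteq> cover S m"
  by (auto elim!: coverE intro: coverI[of "a + _"] simp: add.assoc)

lemma mcoeff_mult_nonzero:
  assumes "mcoeff (f * g) m \<noteq> 0"
  obtains a b where "a + b = m" "mcoeff f a \<noteq> 0" "mcoeff g b \<noteq> 0"
proof -
  have "\<exists>p\<in>splits m. mcoeff f (fst p) * mcoeff g (snd p) \<noteq> 0"
    using assms unfolding mcoeff_mult case_prod_unfold by (metis (mono_tags, lifting) sum.neutral)
  then show ?thesis using that by auto
qed

text \<open>The multipliers \<open>c i\<close> are arbitrary, for instance a row of the Hessian:
  local finiteness of the other factor already confines the support at \<open>m\<close> to a cover
  of \<open>m\<close>.\<close>

lemma locfin_mult: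
  assumes "locfin f"
  shows "locfin (\<lambda>i. c i * f i)"
  unfolding locfin_def
proof
  fix m
  show "finite {i. mcoeff (c i * f i) m \<noteq> 0}"
  proof (rule finite_subset)
    show "{i. mcoeff (c i * f i) m \<noteq> 0} \<subseteq> cover (\<lambda>b. {i. mcoeff (f i) b \<noteq> 0}) m"
      by (auto elim!: mcoeff_mult_nonzero intro: coverI)
  qed (use assms in \<open>simp add: locfin_def\<close>)
qed

lemma locfin_mult': "locfin f \<Longrightarrow> locfin (\<lambda>i. f i * c i)"
  using locfin_mult[of f c] by (simp add: mult.commute)

lemma locfin_comp: "locfin f \<Longrightarrow> inj s \<Longrightarrow> locfin (\<lambda>i. f (s i))"
  unfolding locfin_def using finite_vimageI[of "{i. mcoeff (f i) _ \<noteq> 0}" s] by (simp add: vimage_def)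

lemma locfin_mvar: "locfin mvar"
  unfolding locfin_def
proof
  fix m :: "'v \<Rightarrow>\<^sub>0 nat"
  show "finite {i. mcoeff (mvar i) m \<noteq> 0}"
    by (rule finite_subset[of _ "keys m"]) (auto simp: mcoeff_mvar)
qed

lemma locfin_finite: "finite {i. f i \<noteq> 0} \<Longrightarrow> locfin f"
  unfolding locfin_def
  by (metis (mono_tags, lifting) Collect_mono finite_subset mcoeff_simps(1))

lemma locfin_delta [simp]: "locfin (\<lambda>i. if i = j then g i else 0)"
  by (rule locfin_finite) (rule finite_subset[of _ "{j}"], auto)

lemma msum_add: "locfin f \<Longrightarrow> locfin g \<Longrightarrow> msum (\<lambda>i. f i + g i) = msum f + msum g"
  by (rule mfps_eqI) (simp add: mcoeff_msum Sum_any.distrib locfinD)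

lemma msum_minus: "msum (\<lambda>i. - f i) = - msum f"
  by (rule mfps_eqI) (simp add: mcoeff_msum Sum_any.expand_set sum_negf)

lemma msum_diff: "locfin f \<Longrightarrow> locfin g \<Longrightarrow> msum (\<lambda>i. f i - g i) = msum f - msum g"
  using msum_add[of f "\<lambda>i. - g i"] locfin_minus[of g] msum_minus[of g] by simp

lemma msum_0 [simp]: "msum (\<lambda>i. 0) = 0"
  by (rule mfps_eqI) (simp add: mcoeff_msum)

lemma msum_sum:
  "(\<And>j. j \<in> J \<Longrightarrow> locfin (f j)) \<Longrightarrow> msum (\<lambda>i. \<Sum>j\<in>J. f j i) = (\<Sum>j\<in>J. msum (f j))"
  by (induction J rule: infinite_finite_induct) (auto simp: msum_add locfin_sum)

lemma msum_delta [simp]: "msum (\<lambda>i. if i = j then g i else 0) = g j"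
proof (rule mfps_eqI)
  fix m
  have "(\<lambda>i. mcoeff (if i = j then g i else 0) m) = (\<lambda>i. if i = j then mcoeff (g i) m else 0)"
    by auto
  then show "mcoeff (msum (\<lambda>i. if i = j then g i else 0)) m = mcoeff (g j) m"
    by (simp only: mcoeff_msum Sum_any.delta)
qed

lemma msum_mult_left:
  assumes "locfin f"
  shows "msum (\<lambda>i. c * f i) = c * msum f"
proof (rule mfps_eqI)
  fix m
  \<comment> \<open>\<open>K\<close> contains the supports at every divisor of \<open>m\<close>, so
    all sums run over \<open>K\<close> and only a swap of finite sums remains.\<close>
  define K where "K = cover (\<lambda>b. {i. mcoeff (f i) b \<noteq> 0}) m"
  have fin: "finite K" using assms by (simp add: K_def locfin_def)
  have "mcoeff (msum (\<lambda>i. c * f i)) m = (\<Sum>i\<in>K. mcoeff (c * f i) m)"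
    by (rule mcoeff_msum_superset[OF fin]) (auto simp: K_def elim!: mcoeff_mult_nonzero intro: coverI)
  also have "\<dots> = (\<Sum>(a, b)\<in>splits m. mcoeff c a * (\<Sum>i\<in>K. mcoeff (f i) b))"
    by (simp add: mcoeff_mult sum_distrib_left case_prod_unfold) (rule sum.swap)
  also have "\<dots> = mcoeff (c * msum f) m"
    unfolding mcoeff_mult
  proof (intro sum.cong refl, clarify)
    fix a b assume "(a, b) \<in> splits m"
    then have "mcoeff (msum f) b = (\<Sum>i\<in>K. mcoeff (f i) b)"
      by (intro mcoeff_msum_superset[OF fin]) (auto simp: K_def intro: coverI)
    then show "mcoeff c a * (\<Sum>i\<in>K. mcoeff (f i) b) = mcoeff c a * mcoeff (msum f) b" by simp
  qed
  finally show "mcoeff (msum (\<lambda>i. c * f i)) m = mcoeff (c * msum f) m" .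
qed

lemma msum_mult_right: "locfin f \<Longrightarrow> msum (\<lambda>i. f i * c) = msum f * c"
  using msum_mult_left[of f c] by (simp add: mult.commute)

text \<open>The double sum at \<open>m\<close> lives on a finite rectangle whatever the kernel
  \<open>h\<close>, since \<open>f\<close> cuts off one index and \<open>g\<close> the other. With
  \<open>h\<close> a Hessian this yields the isotropy of tangent spaces.\<close>

lemma msum_swap:
  assumes f: "locfin f" and g: "locfin g"
  shows "msum (\<lambda>i. msum (\<lambda>j. h i j * g j) * f i) = msum (\<lambda>j. msum (\<lambda>i. h i j * f i) * g j)"
proof -
  have "msum (\<lambda>i. msum (\<lambda>j. h i j * g j) * f i) = msum (\<lambda>i. msum (\<lambda>j. h i j * g j * f i))"
    by (simp add: msum_mult_right locfin_mult g)
  also have "\<dots> = msum (\<lambda>j. msum (\<lambda>i. h i j * g j * f i))"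
  proof (rule mfps_eqI)
    fix m
    let ?Kf = "cover (\<lambda>b. {i. mcoeff (f i) b \<noteq> 0}) m"
    let ?Kg = "cover (\<lambda>b. {i. mcoeff (g i) b \<noteq> 0}) m"
    have "finite (?Kf \<times> ?Kg)"
      using f g by (simp add: locfin_def)
    moreover have "{i. \<exists>j. mcoeff (h i j * g j * f i) m \<noteq> 0} \<subseteq> ?Kf"
      by (auto elim!: mcoeff_mult_nonzero intro: coverI)
    moreover have "{j. \<exists>i. mcoeff (h i j * g j * f i) m \<noteq> 0} \<subseteq> ?Kg"
    proof safe
      fix i j assume "mcoeff (h i j * g j * f i) m \<noteq> 0"
      then have "mcoeff (h i j * f i * g j) m \<noteq> 0" by (simp add: ac_simps)
      then show "j \<in> ?Kg" by (auto elim!: mcoeff_mult_nonzero[of "h i j * f i"] intro: coverI)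
    qed
    ultimately show "mcoeff (msum (\<lambda>i. msum (\<lambda>j. h i j * g j * f i))) m =
        mcoeff (msum (\<lambda>j. msum (\<lambda>i. h i j * g j * f i))) m"
      unfolding mcoeff_msum by (intro Sum_any.swap[of "?Kf \<times> ?Kg"]) auto
  qed
  also have "\<dots> = msum (\<lambda>j. msum (\<lambda>i. h i j * f i) * g j)"
  proof (rule arg_cong[of _ _ msum], rule ext)
    fix j
    have "msum (\<lambda>i. h i j * g j * f i) = msum (\<lambda>i. h i j * f i * g j)"
      by (simp add: ac_simps)
    then show "msum (\<lambda>i. h i j * g j * f i) = msum (\<lambda>i. h i j * f i) * g j"
      by (simp add: msum_mult_right locfin_mult f)
  qed
  finally show ?thesis .
qed

text \<open>Differentiation multiplies coefficients by the nonzero number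
  \<open>lookup m i + 1\<close>, so both \<open>Sum_any\<close> range over the same index set,
  finite or not.\<close>

lemma pd_msum: "pd i (msum f) = msum (\<lambda>j. pd i (f j))"
proof (rule mfps_eqI)
  fix m
  have "(of_nat (lookup m i + 1) :: complex) \<noteq> 0"
    by (metis Suc_eq_plus1 nat.simps(3) of_nat_eq_0_iff)
  then have "{j. of_nat (lookup m i + 1) * mcoeff (f j) (m + unit_exp i) \<noteq> 0} =
      {j. mcoeff (f j) (m + unit_exp i) \<noteq> 0}"
    by (auto simp del: of_nat_add of_nat_Suc)
  then show "mcoeff (pd i (msum f)) m = mcoeff (msum (\<lambda>j. pd i (f j))) m"
    unfolding mcoeff_pd mcoeff_msum Sum_any.expand_set by (simp only: sum_distrib_left)
qed

section \<open>Substitution\<close>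

definition mpow :: "('u \<Rightarrow> 'v mfps) \<Rightarrow> ('u \<Rightarrow>\<^sub>0 nat) \<Rightarrow> 'v mfps"
  where "mpow x a = (\<Prod>i\<in>keys a. x i ^ lookup a i)"

lemma mpow_superset: "finite K \<Longrightarrow> keys a \<subseteq> K \<Longrightarrow> mpow x a = (\<Prod>i\<in>K. x i ^ lookup a i)"
  unfolding mpow_def by (rule prod.mono_neutral_left) (auto simp: in_keys_iff)

lemma mpow_add: "mpow x (a + b) = mpow x a * mpow x b"
proof -
  let ?K = "keys a \<union> keys b"
  have "mpow x (a + b) = (\<Prod>i\<in>?K. x i ^ lookup (a + b) i)"
    by (rule mpow_superset) (auto simp: keys_add_exponent)
  also have "\<dots> = (\<Prod>i\<in>?K. x i ^ lookup a i) * (\<Prod>i\<in>?K. x i ^ lookup b i)"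
    by (simp add: lookup_add power_add prod.distrib)
  also have "\<dots> = mpow x a * mpow x b"
    by (simp add: mpow_superset[of ?K])
  finally show ?thesis .
qed

lemma mpow_0 [simp]: "mpow x 0 = 1"
  by (simp add: mpow_def)

lemma mpow_unit_exp [simp]: "mpow x (unit_exp i) = x i"
  by (simp add: mpow_def lookup_unit_exp)

lemma mcoeff_mpow_mvar: "mcoeff (mpow mvar a) m = (if m = a then 1 else 0)"
proof (induction a arbitrary: m rule: exponent_induct)
  case zero
  then show ?case by (simp add: mcoeff_one)
next
  case (add a i)
  show ?case
  proof (cases "lookup m i = 0")
    case True
    then show ?thesis
      by (auto simp: mpow_add mult.commute[of _ "mvar i"] mcoeff_mvar_mult_eq_0 lookup_add lookup_unit_exp)
  next
    case False
    then obtain m' where "m = m' + unit_exp i" by (rule split_off_unit_exp)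
    then show ?thesis
      using add by (simp add: mpow_add mult.commute[of _ "mvar i"] mcoeff_mvar_mult)
  qed
qed

lemma msubst_mvar [simp]: "msubst f mvar = f"
proof (rule mfps_eqI)
  fix m
  have "Sum_any (\<lambda>a. mcoeff f a * mcoeff (mpow mvar a) m) = Sum_any (\<lambda>a. if a = m then mcoeff f a else 0)"
    by (rule Sum_any.cong) (simp add: mcoeff_mpow_mvar)
  then show "mcoeff (msubst f mvar) m = mcoeff f m"
    by (simp add: msubst_def mpow_def[symmetric])
qed

text \<open>\<open>S\<close> is kept apart from \<open>x\<close> so that one choice bounds all
  points of a line \<open>x + \<tau> r\<close> simultaneously. The condition
  \<open>m \<noteq> 0\<close> encodes vanishing constant terms.\<close>

definition bounded_by :: "(('v \<Rightarrow>\<^sub>0 nat) \<Rightarrow> 'u set) \<Rightarrow> ('u \<Rightarrow> 'v mfps) \<Rightarrow> bool"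
  where "bounded_by S x \<longleftrightarrow> (\<forall>i m. mcoeff (x i) m \<noteq> 0 \<longrightarrow> i \<in> S m \<and> m \<noteq> 0)"

text \<open>The exponents \<open>a\<close> for which \<open>mpow x a\<close> can have a coefficient
  at \<open>m\<close> when \<open>x\<close> is bounded by \<open>S\<close>: the variables come from
  divisors of \<open>m\<close>, and each factor has zero constant term, hence uses up at least one
  degree of \<open>m\<close>.\<close>

definition indices :: "(('v \<Rightarrow>\<^sub>0 nat) \<Rightarrow> 'u set) \<Rightarrow> ('v \<Rightarrow>\<^sub>0 nat) \<Rightarrow> ('u \<Rightarrow>\<^sub>0 nat) set"
  where "indices S m = {a. keys a \<subseteq> cover S m \<and> mdeg a \<le> mdeg m}"

lemma finite_indices:
  assumes "\<And>m. finite (S m)"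
  shows "finite (indices S m)"
proof -
  let ?B = "{h. \<forall>i. (i \<in> cover S m \<longrightarrow> h i \<in> {..mdeg m}) \<and> (i \<notin> cover S m \<longrightarrow> h i = 0)}"
  have "lookup ` indices S m \<subseteq> ?B"
  proof (intro subsetI, elim imageE, intro CollectI allI conjI impI)
    fix h a i assume "h = lookup a" "a \<in> indices S m" "i \<in> cover S m"
    then show "h i \<in> {..mdeg m}"
      using order_trans[OF lookup_le_mdeg[of a i]] by (auto simp: indices_def)
  next
    fix h a i assume "h = lookup a" "a \<in> indices S m" "i \<notin> cover S m"
    then show "h i = 0" by (auto simp: indices_def in_keys_iff)
  qed
  moreover have "finite ?B"
    using assms by (intro finite_set_of_finite_funs) auto
  ultimately have "finite (lookup ` indices S m)" by (rule finite_subset)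
  then show ?thesis by (rule finite_imageD) (simp add: inj_on_def lookup_inject)
qed

lemma indices_add:
  assumes "a \<in> indices S b" "i \<in> S c" "c \<noteq> 0" "b + c = m"
  shows "a + unit_exp i \<in> indices S m"
proof -
  have "cover S b \<subseteq> cover S m" using cover_mono[of c b m S] assms(4) by (simp add: add.commute)
  moreover have "i \<in> cover S m" using assms(2,4) by (auto intro: coverI)
  moreover have "mdeg c \<ge> 1" using assms(3) by (simp add: Suc_le_eq flip: neq0_conv)
  ultimately show ?thesis
    using assms(1,4) by (auto simp: indices_def keys_add_exponent)
qed

lemma indices_mono: "a + b = m \<Longrightarrow> indices S b \<subseteq> indices S m"
  using cover_mono[of a b m S] by (auto simp: indices_def)

lemma indices_add_left: "a + b \<in> indices S m \<Longrightarrow> a \<in> indices S m"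
  by (auto simp: indices_def keys_add_exponent)

lemma mpow_support:
  assumes "bounded_by S x" "mcoeff (mpow x a) m \<noteq> 0"
  shows "a \<in> indices S m"
  using assms(2)
proof (induction a arbitrary: m rule: exponent_induct)
  case zero
  then show ?case by (simp add: indices_def)
next
  case (add a i)
  from add.prems obtain b c where "b + c = m" "mcoeff (mpow x a) b \<noteq> 0" "mcoeff (x i) c \<noteq> 0"
    by (auto simp: mpow_add elim: mcoeff_mult_nonzero)
  then show ?case
    using add.IH assms(1) by (auto simp: bounded_by_def intro!: indices_add)
qed

lemma mcoeff_msubst:
  assumes "bounded_by S x" "finite A" "indices S m \<subseteq> A"
  shows "mcoeff (msubst f x) m = (\<Sum>a\<in>A. mcoeff f a * mcoeff (mpow x a) m)"
  unfolding msubst_def mcoeff_MFPS mpow_def[symmetric]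
  by (rule Sum_any.expand_superset) (use assms mpow_support in fastforce)+

definition admissible :: "('u \<Rightarrow> 'v mfps) \<Rightarrow> bool"
  where "admissible x \<longleftrightarrow> locfin x \<and> (\<forall>i. mcoeff (x i) 0 = 0)"

lemma admissibleE:
  assumes "admissible x"
  obtains S where "\<And>m. finite (S m)" "bounded_by S x"
  using that[of "\<lambda>m. {i. mcoeff (x i) m \<noteq> 0}"] assms
  by (auto simp: admissible_def locfin_def bounded_by_def)

lemma admissible_mvar: "admissible mvar"
  by (auto simp: admissible_def locfin_mvar mcoeff_mvar dest: arg_cong[of _ _ mdeg])

lemma msubst_add:
  assumes "admissible x"
  shows "msubst (f + g) x = msubst f x + msubst g x"
proof -
  obtain S where S: "\<And>m. finite (S m)" "bounded_by S x" using assms by (rule admissibleE) blast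
  show ?thesis
    by (rule mfps_eqI) (simp add: mcoeff_msubst[OF S(2) finite_indices[OF S(1)] order_refl]
        algebra_simps sum.distrib)
qed

lemma msubst_minus:
  assumes "admissible x"
  shows "msubst (- f) x = - msubst f x"
proof -
  obtain S where S: "\<And>m. finite (S m)" "bounded_by S x" using assms by (rule admissibleE) blast
  show ?thesis
    by (rule mfps_eqI) (simp add: mcoeff_msubst[OF S(2) finite_indices[OF S(1)] order_refl] sum_negf)
qed

lemma msubst_diff: "admissible x \<Longrightarrow> msubst (f - g) x = msubst f x - msubst g x"
  using msubst_add[of x f "- g"] msubst_minus[of x g] by simp

lemma msubst_0 [simp]: "msubst 0 x = 0"
  by (rule mfps_eqI) (simp add: msubst_def)

lemma msubst_sum: "admissible x \<Longrightarrow> msubst (sum f J) x = (\<Sum>j\<in>J. msubst (f j) x)"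
  by (induction J rule: infinite_finite_induct) (simp_all add: msubst_add)

lemma msubst_mconst [simp]: "msubst (mconst c) x = mconst c"
proof (rule mfps_eqI)
  fix m
  have "Sum_any (\<lambda>a. mcoeff (mconst c) a * mcoeff (mpow x a) m) =
      Sum_any (\<lambda>a. if a = 0 then c * mcoeff (mpow x a) m else 0)"
    by (rule Sum_any.cong) (simp add: mcoeff_mconst)
  then show "mcoeff (msubst (mconst c) x) m = mcoeff (mconst c) m"
    unfolding msubst_def mpow_def[symmetric] mcoeff_MFPS Sum_any.delta
    by (simp add: mcoeff_one) (simp add: mcoeff_mconst)
qed

lemma msubst_1 [simp]: "msubst 1 x = 1"
  using msubst_mconst[of 1] by simp

lemma msubst_var [simp]: "msubst (mvar i) x = x i"
proof (rule mfps_eqI)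
  fix m
  have "Sum_any (\<lambda>a. mcoeff (mvar i) a * mcoeff (mpow x a) m) =
      Sum_any (\<lambda>a. if a = unit_exp i then mcoeff (mpow x a) m else 0)"
    by (rule Sum_any.cong) (simp add: mcoeff_mvar)
  then show "mcoeff (msubst (mvar i) x) m = mcoeff (x i) m"
    by (simp add: msubst_def mpow_def[symmetric])
qed

lemma msubst_mult:
  assumes "admissible x"
  shows "msubst (f * g) x = msubst f x * msubst g x"
proof (rule mfps_eqI)
  fix m
  obtain S where S: "\<And>m. finite (S m)" "bounded_by S x" using assms by (rule admissibleE) blast
  let ?A = "indices S m"
  let ?t = "\<lambda>(b, c). mcoeff f b * mcoeff g c * mcoeff (mpow x (b + c)) m"
  have fin: "finite ?A" by (rule finite_indices[OF S(1)])
  have "mcoeff (msubst (f * g) x) m = (\<Sum>a\<in>?A. \<Sum>p\<in>splits a. ?t p)"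
    unfolding mcoeff_msubst[OF S(2) fin order_refl] mcoeff_mult sum_distrib_right
    by (intro sum.cong refl) auto
  also have "\<dots> = (\<Sum>p\<in>(\<Union>a\<in>?A. splits a). ?t p)"
    by (rule sum.UNION_disjoint[symmetric]) (auto simp: fin)
  \<comment> \<open>The rectangle also contains pairs with \<open>b + c\<close> outside
    \<open>?A\<close>; there \<open>mpow x (b + c)\<close> has no coefficient at \<open>m\<close>,
    so the sum can be extended and then factorises.\<close>
  also have "\<dots> = (\<Sum>p\<in>?A \<times> ?A. ?t p)"
  proof (rule sum.mono_neutral_left)
    show "finite (?A \<times> ?A)" using fin by simp
    show "(\<Union>a\<in>?A. splits a) \<subseteq> ?A \<times> ?A"
    proof clarify
      fix b c a assume "a \<in> ?A" "(b, c) \<in> splits a"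
      then have "b + c \<in> ?A" "c + b \<in> ?A" by (simp_all add: add.commute)
      then show "b \<in> ?A \<and> c \<in> ?A" using indices_add_left by blast
    qed
    show "\<forall>p\<in>?A \<times> ?A - (\<Union>a\<in>?A. splits a). ?t p = 0"
    proof clarify
      fix b c assume "(b, c) \<notin> (\<Union>a\<in>?A. splits a)"
      then have "b + c \<notin> ?A" by simp
      then have "mcoeff (mpow x (b + c)) m = 0" using mpow_support[OF S(2)] by blast
      then show "mcoeff f b * mcoeff g c * mcoeff (mpow x (b + c)) m = 0" by simp
    qed
  qed
  also have "\<dots> = (\<Sum>b\<in>?A. \<Sum>c\<in>?A. \<Sum>(k, l)\<in>splits m.
      (mcoeff f b * mcoeff (mpow x b) k) * (mcoeff g c * mcoeff (mpow x c) l))"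
    unfolding sum.cartesian_product[symmetric] mpow_add mcoeff_mult
    by (simp add: sum_distrib_left case_prod_unfold ac_simps)
  also have "\<dots> = (\<Sum>(k, l)\<in>splits m. (\<Sum>b\<in>?A. mcoeff f b * mcoeff (mpow x b) k) *
      (\<Sum>c\<in>?A. mcoeff g c * mcoeff (mpow x c) l))"
    unfolding sum_product case_prod_unfold
    by (rule sym, rule trans[OF sum.swap], intro sum.cong refl, rule sum.swap)
  also have "\<dots> = mcoeff (msubst f x * msubst g x) m"
    unfolding mcoeff_mult
  proof (intro sum.cong refl, clarify)
    fix k l assume "(k, l) \<in> splits m"
    then have "indices S k \<subseteq> ?A" "indices S l \<subseteq> ?A"
      using indices_mono[of k l m S] indices_mono[of l k m S] by (auto simp: add.commute)
    then show "(\<Sum>b\<in>?A. mcoeff f b * mcoeff (mpow x b) k) * (\<Sum>c\<in>?A. mcoeff g c * mcoeff (mpow x c) l) =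
        mcoeff (msubst f x) k * mcoeff (msubst g x) l"
      by (simp add: mcoeff_msubst[OF S(2) fin])
  qed
  finally show "mcoeff (msubst (f * g) x) m = mcoeff (msubst f x * msubst g x) m" .
qed

lemma msubst_msum:
  assumes "admissible x" "locfin f"
  shows "msubst (msum f) x = msum (\<lambda>j. msubst (f j) x)"
proof (rule mfps_eqI)
  fix m
  obtain S where S: "\<And>m. finite (S m)" "bounded_by S x" using assms(1) by (rule admissibleE) blast
  let ?A = "indices S m"
  have fin: "finite ?A" by (rule finite_indices[OF S(1)])
  define K where "K = (\<Union>a\<in>?A. {j. mcoeff (f j) a \<noteq> 0})"
  have K: "finite K" unfolding K_def using fin assms(2) by (auto simp: locfin_def)
  have *: "mcoeff (msum f) a = (\<Sum>j\<in>K. mcoeff (f j) a)" if "a \<in> ?A" for a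
    using that by (intro mcoeff_msum_superset[OF K]) (auto simp: K_def)
  have "{j. mcoeff (msubst (f j) x) m \<noteq> 0} \<subseteq> K"
  proof clarify
    fix j assume "mcoeff (msubst (f j) x) m \<noteq> 0"
    then have "\<exists>a\<in>?A. mcoeff (f j) a * mcoeff (mpow x a) m \<noteq> 0"
      unfolding mcoeff_msubst[OF S(2) fin order_refl] by (meson sum.neutral)
    then show "j \<in> K" by (auto simp: K_def)
  qed
  then have "mcoeff (msum (\<lambda>j. msubst (f j) x)) m = (\<Sum>j\<in>K. mcoeff (msubst (f j) x) m)"
    by (rule mcoeff_msum_superset[OF K])
  also have "\<dots> = mcoeff (msubst (msum f) x) m"
    by (simp add: mcoeff_msubst[OF S(2) fin order_refl] * sum_distrib_right) (rule sum.swap)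
  finally show "mcoeff (msubst (msum f) x) m = mcoeff (msum (\<lambda>j. msubst (f j) x)) m" ..
qed

section \<open>The chain rule along complex lines\<close>

text \<open>Differentiation in a complex parameter, coefficient by coefficient, so that no topology
  on the series is involved.\<close>

definition mderiv :: "(complex \<Rightarrow> 'v mfps) \<Rightarrow> (complex \<Rightarrow> 'v mfps) \<Rightarrow> bool"
  where "mderiv X X' \<longleftrightarrow>
    (\<forall>\<tau> m. ((\<lambda>\<tau>. mcoeff (X \<tau>) m) has_field_derivative mcoeff (X' \<tau>) m) (at \<tau>))"

lemma mderiv_const: "mderiv (\<lambda>_. c) (\<lambda>_. 0)"
  by (simp add: mderiv_def)

lemma mderiv_line: "mderiv (\<lambda>\<tau>. x + mconst \<tau> * r) (\<lambda>_. r)"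
  unfolding mderiv_def by (auto intro!: derivative_eq_intros)

lemma mderiv_diff: "mderiv X X' \<Longrightarrow> mderiv Y Y' \<Longrightarrow> mderiv (\<lambda>\<tau>. X \<tau> - Y \<tau>) (\<lambda>\<tau>. X' \<tau> - Y' \<tau>)"
  unfolding mderiv_def by (auto intro!: derivative_eq_intros)

lemma mderiv_mult:
  assumes "mderiv X X'" "mderiv Y Y'"
  shows "mderiv (\<lambda>\<tau>. X \<tau> * Y \<tau>) (\<lambda>\<tau>. X' \<tau> * Y \<tau> + X \<tau> * Y' \<tau>)"
  unfolding mderiv_def
proof (intro allI)
  fix \<tau> m
  have "((\<lambda>\<tau>. \<Sum>p\<in>splits m. mcoeff (X \<tau>) (fst p) * mcoeff (Y \<tau>) (snd p)) has_field_derivative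
     (\<Sum>p\<in>splits m. mcoeff (X \<tau>) (fst p) * mcoeff (Y' \<tau>) (snd p) + mcoeff (X' \<tau>) (fst p) * mcoeff (Y \<tau>) (snd p))) (at \<tau>)"
    using assms unfolding mderiv_def by (intro DERIV_sum DERIV_mult') auto
  then show "((\<lambda>\<tau>. mcoeff (X \<tau> * Y \<tau>) m) has_field_derivative
      mcoeff (X' \<tau> * Y \<tau> + X \<tau> * Y' \<tau>) m) (at \<tau>)"
    by (simp add: mcoeff_mult case_prod_unfold sum.distrib add.commute)
qed

lemma mderiv_unique: "mderiv X X' \<Longrightarrow> mderiv X Y' \<Longrightarrow> X' \<tau> = Y' \<tau>"
  unfolding mderiv_def by (intro mfps_eqI) (metis DERIV_unique)

text \<open>\<open>K\<close> is fixed beforehand so that one sum serves all exponents in a finite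
  set. Truncation in \<open>a - unit_exp i\<close> does no harm: it occurs only where the factor
  \<open>lookup a i\<close> is zero.\<close>

lemma mderiv_mpow:
  assumes "finite K" "keys a \<subseteq> K"
  shows "mderiv (\<lambda>\<tau>. mpow (\<lambda>i. x i + mconst \<tau> * r i) a)
    (\<lambda>\<tau>. \<Sum>i\<in>K. of_nat (lookup a i) * mpow (\<lambda>i. x i + mconst \<tau> * r i) (a - unit_exp i) * r i)"
  using assms(2)
proof (induction a rule: exponent_induct)
  case zero
  then show ?case using mderiv_const[of 1] by simp
next
  case (add a j)
  define y where "y \<tau> i = x i + mconst \<tau> * r i" for \<tau> i
  have j: "j \<in> K" "keys a \<subseteq> K" using add.prems by (auto simp: keys_add_exponent)
  have "mderiv (\<lambda>\<tau>. mpow (y \<tau>) a * y \<tau> j)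
    (\<lambda>\<tau>. (\<Sum>i\<in>K. of_nat (lookup a i) * mpow (y \<tau>) (a - unit_exp i) * r i) * y \<tau> j + mpow (y \<tau>) a * r j)"
    unfolding y_def by (rule mderiv_mult[OF add.IH[OF j(2)] mderiv_line])
  moreover have "(\<Sum>i\<in>K. of_nat (lookup a i) * mpow (y \<tau>) (a - unit_exp i) * r i) * y \<tau> j + mpow (y \<tau>) a * r j
     = (\<Sum>i\<in>K. of_nat (lookup (a + unit_exp j) i) * mpow (y \<tau>) (a + unit_exp j - unit_exp i) * r i)" (is "?l = ?r") for \<tau>
  proof -
    have "?r = (\<Sum>i\<in>K. of_nat (lookup a i) * mpow (y \<tau>) (a - unit_exp i) * r i * y \<tau> j
        + (if i = j then mpow (y \<tau>) a * r j else 0))"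
    proof (rule sum.cong[OF refl])
      fix i
      show "of_nat (lookup (a + unit_exp j) i) * mpow (y \<tau>) (a + unit_exp j - unit_exp i) * r i =
          of_nat (lookup a i) * mpow (y \<tau>) (a - unit_exp i) * r i * y \<tau> j
          + (if i = j then mpow (y \<tau>) a * r j else 0)"
      proof (cases "lookup a i = 0")
        case True
        then show ?thesis by (auto simp: lookup_add lookup_unit_exp)
      next
        case False
        then obtain b where b: "a = b + unit_exp i" by (rule split_off_unit_exp)
        have *: "b + unit_exp i + unit_exp j - unit_exp i = b + unit_exp j"
          by (metis add.assoc add.commute add_diff_cancel_right')
        show ?thesis unfolding b *
          by (auto simp: lookup_add lookup_unit_exp mpow_add algebra_simps)
      qed
    qed
    then show ?thesis
      using assms(1) j by (simp add: sum.distrib sum.delta sum_distrib_right)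
  qed
  ultimately show ?case unfolding y_def[symmetric] by (simp add: mpow_add)
qed

text \<open>The coefficient at \<open>m\<close> is a sum over \<open>indices S m\<close>, a finite
  set independent of \<tau>, so it can be differentiated term by term. Replacing \<open>a\<close> by
  \<open>a + unit_exp i\<close> then turns the exponent times the coefficient of \<open>f\<close>
  into a coefficient of \<open>pd i f\<close>.\<close>

lemma mderiv_msubst:
  assumes "admissible x" "admissible r"
  shows "mderiv (\<lambda>\<tau>. msubst f (\<lambda>i. x i + mconst \<tau> * r i))
    (\<lambda>\<tau>. msum (\<lambda>i. msubst (pd i f) (\<lambda>i. x i + mconst \<tau> * r i) * r i))"
  unfolding mderiv_def
proof (intro allI)
  fix \<tau> m
  define S where "S m = {i. mcoeff (x i) m \<noteq> 0} \<union> {i. mcoeff (r i) m \<noteq> 0}" for m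
  define y where "y \<tau> i = x i + mconst \<tau> * r i" for \<tau> i
  have S: "finite (S m)" for m using assms by (auto simp: S_def admissible_def locfin_def)
  have r: "bounded_by S r" using assms by (auto simp: S_def bounded_by_def admissible_def)
  have y: "bounded_by S (y \<tau>)" for \<tau>
    using assms by (auto simp: S_def y_def bounded_by_def admissible_def)
  let ?A = "indices S m" let ?K = "cover S m"
  have A: "finite ?A" by (rule finite_indices[OF S])
  have K: "finite ?K" using S by simp
  have d: "((\<lambda>\<tau>. \<Sum>a\<in>?A. mcoeff f a * mcoeff (mpow (y \<tau>) a) m) has_field_derivative
      (\<Sum>a\<in>?A. mcoeff f a * mcoeff (\<Sum>i\<in>?K. of_nat (lookup a i) * mpow (y \<tau>) (a - unit_exp i) * r i) m)) (at \<tau>)"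
  proof (rule DERIV_sum, rule DERIV_cmult)
    fix a assume "a \<in> ?A"
    then have "keys a \<subseteq> ?K" by (auto simp: indices_def)
    from mderiv_mpow[OF K this, of x r] show "((\<lambda>\<tau>. mcoeff (mpow (y \<tau>) a) m) has_field_derivative
        mcoeff (\<Sum>i\<in>?K. of_nat (lookup a i) * mpow (y \<tau>) (a - unit_exp i) * r i) m) (at \<tau>)"
      unfolding mderiv_def y_def by blast
  qed
  let ?u = "\<lambda>(a, i). of_nat (lookup a i) * mcoeff f a * mcoeff (mpow (y \<tau>) (a - unit_exp i) * r i) m"
  let ?v = "\<lambda>(a, i). of_nat (lookup a i + 1) * mcoeff f (a + unit_exp i) * mcoeff (mpow (y \<tau>) a * r i) m"
  have of_nat: "mcoeff (of_nat n * g) k = of_nat n * mcoeff g k" for n k and g :: "'b mfps"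
    by (induction n) (simp_all add: algebra_simps)
  have "(\<Sum>a\<in>?A. mcoeff f a * mcoeff (\<Sum>i\<in>?K. of_nat (lookup a i) * mpow (y \<tau>) (a - unit_exp i) * r i) m)
      = (\<Sum>p\<in>?A \<times> ?K. ?u p)"
    unfolding sum.cartesian_product[symmetric] mcoeff_sum sum_distrib_left
      mult.assoc[of "of_nat _" _ "r _"] of_nat
    by (intro sum.cong refl) (simp add: mult.left_commute)
  also have "\<dots> = (\<Sum>p\<in>{p \<in> ?A \<times> ?K. lookup (fst p) (snd p) \<noteq> 0}. ?u p)"
    using A K by (intro sum.mono_neutral_right) auto
  also have "\<dots> = (\<Sum>p\<in>{p \<in> ?A \<times> ?K. fst p + unit_exp (snd p) \<in> ?A}. ?v p)"
  proof (rule sum.reindex_bij_witness[of _ "\<lambda>(a, i). (a + unit_exp i, i)" "\<lambda>(a, i). (a - unit_exp i, i)"], goal_cases)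
    case (1 p)
    then show ?case by (cases p) (simp add: diff_add_unit_exp)
  next
    case (2 p)
    have "fst p - unit_exp (snd p) \<in> ?A"
      by (rule indices_add_left[of _ "unit_exp (snd p)"]) (use 2 in \<open>auto simp: diff_add_unit_exp\<close>)
    with 2 show ?case by (cases p) (simp add: diff_add_unit_exp)
  next
    case (3 p)
    then show ?case by (cases p) simp
  next
    case (4 p)
    then show ?case by (cases p) (simp add: lookup_add lookup_unit_exp)
  next
    case (5 p)
    obtain a i where p: "p = (a, i)" by (cases p)
    with 5 have a: "a - unit_exp i + unit_exp i = a" by (simp add: diff_add_unit_exp)
    have "lookup (a - unit_exp i) i + 1 = lookup (a - unit_exp i + unit_exp i) i"
      by (simp add: lookup_add lookup_unit_exp)
    then show ?case unfolding p prod.case a by (simp only:)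
  qed
  \<comment> \<open>If \<open>a + unit_exp i\<close> is outside \<open>?A\<close>, then
    \<open>mpow (y \<tau>) a * r i\<close> has no coefficient at \<open>m\<close>, because
    \<open>y \<tau>\<close> and \<open>r\<close> share the bound \<open>S\<close>.\<close>
  also have "\<dots> = (\<Sum>p\<in>?A \<times> ?K. ?v p)"
  proof (rule sum.mono_neutral_left)
    show "\<forall>p\<in>?A \<times> ?K - {p \<in> ?A \<times> ?K. fst p + unit_exp (snd p) \<in> ?A}. ?v p = 0"
    proof
      fix p assume "p \<in> ?A \<times> ?K - {p \<in> ?A \<times> ?K. fst p + unit_exp (snd p) \<in> ?A}"
      then obtain a i where p: "p = (a, i)" "a + unit_exp i \<notin> ?A" by auto
      have "mcoeff (mpow (y \<tau>) a * r i) m = 0"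
      proof (rule ccontr)
        assume "mcoeff (mpow (y \<tau>) a * r i) m \<noteq> 0"
        then obtain b c where "b + c = m" "mcoeff (mpow (y \<tau>) a) b \<noteq> 0" "mcoeff (r i) c \<noteq> 0"
          by (rule mcoeff_mult_nonzero)
        then have "a + unit_exp i \<in> ?A"
          using mpow_support[OF y] r by (intro indices_add[of a S b i c]) (auto simp: bounded_by_def)
        with p show False by simp
      qed
      then show "?v p = 0" by (simp add: p)
    qed
  qed (use A K in auto)
  also have "\<dots> = (\<Sum>i\<in>?K. \<Sum>a\<in>?A. ?v (a, i))"
    by (simp add: sum.cartesian_product[symmetric]) (rule sum.swap)
  also have "\<dots> = (\<Sum>i\<in>?K. mcoeff (msubst (pd i f) (y \<tau>) * r i) m)"
  proof (rule sum.cong[OF refl])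
    fix i
    have "mcoeff (msubst (pd i f) (y \<tau>) * r i) m =
        (\<Sum>(k, l)\<in>splits m. (\<Sum>a\<in>?A. mcoeff (pd i f) a * mcoeff (mpow (y \<tau>) a) k) * mcoeff (r i) l)"
      unfolding mcoeff_mult
    proof (intro sum.cong refl, clarify)
      fix k l assume "(k, l) \<in> splits m"
      then have "indices S k \<subseteq> ?A"
        using indices_mono[of l k m S] by (auto simp: add.commute)
      then show "mcoeff (msubst (pd i f) (y \<tau>)) k * mcoeff (r i) l =
          (\<Sum>a\<in>?A. mcoeff (pd i f) a * mcoeff (mpow (y \<tau>) a) k) * mcoeff (r i) l"
        by (simp add: mcoeff_msubst[OF y A])
    qed
    also have "\<dots> = (\<Sum>a\<in>?A. ?v (a, i))"
      unfolding mcoeff_mult sum_distrib_left sum_distrib_right case_prod_unfold fst_conv snd_conv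
      by (subst sum.swap) (simp add: mcoeff_pd mult.assoc)
    finally show "(\<Sum>a\<in>?A. ?v (a, i)) = mcoeff (msubst (pd i f) (y \<tau>) * r i) m" ..
  qed
  also have "\<dots> = mcoeff (msum (\<lambda>i. msubst (pd i f) (y \<tau>) * r i)) m"
    using r by (intro mcoeff_msum_superset[OF K, symmetric])
      (auto elim!: mcoeff_mult_nonzero intro: coverI simp: bounded_by_def)
  finally have eq: "(\<Sum>a\<in>?A. mcoeff f a *
        mcoeff (\<Sum>i\<in>?K. of_nat (lookup a i) * mpow (y \<tau>) (a - unit_exp i) * r i) m) =
      mcoeff (msum (\<lambda>i. msubst (pd i f) (y \<tau>) * r i)) m" .
  have "((\<lambda>\<tau>. mcoeff (msubst f (y \<tau>)) m) has_field_derivative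
      mcoeff (msum (\<lambda>i. msubst (pd i f) (y \<tau>) * r i)) m) (at \<tau>)"
    unfolding mcoeff_msubst[OF y A order_refl] eq[symmetric] by (rule d)
  moreover have "y \<tau> = (\<lambda>i. x i + mconst \<tau> * r i)" for \<tau>
    by (simp add: y_def fun_eq_iff)
  ultimately show "((\<lambda>\<tau>. mcoeff (msubst f (\<lambda>i. x i + mconst \<tau> * r i)) m) has_field_derivative
      mcoeff (msum (\<lambda>i. msubst (pd i f) (\<lambda>i. x i + mconst \<tau> * r i) * r i)) m) (at \<tau>)"
    by (simp only:)
qed

lemma mderiv_zero_imp_const:
  assumes "\<And>\<tau>. ((\<lambda>\<tau>. mcoeff (X \<tau>) m) has_field_derivative 0) (at \<tau>)"
  shows "mcoeff (X \<tau>) m = mcoeff (X 0) m"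
proof -
  have "\<exists>c. \<forall>\<tau>\<in>UNIV. mcoeff (X \<tau>) m = c"
    by (rule has_field_derivative_zero_constant) (simp_all add: assms)
  then show ?thesis by auto
qed

section \<open>Sums over the coordinates\<close>

definition raise :: "'n \<times> nat \<Rightarrow> 'n \<times> nat"
  where "raise x = (fst x, Suc (snd x))"

lemma raise_Pair [simp]: "raise (\<alpha>, k) = (\<alpha>, Suc k)"
  by (simp add: raise_def)

lemma raise_eq_iff [simp]: "raise x = raise y \<longleftrightarrow> x = y"
  by (cases x, cases y) simp

lemma raise_neq_0 [simp]: "raise x \<noteq> (\<alpha>, 0)" "(\<alpha>, 0) \<noteq> raise x"
  by (simp_all add: raise_def)

lemma inj_raise: "inj raise"
  by (simp add: inj_def)

lemma coord_cases:
  obtains (zero) \<alpha> where "x = (\<alpha>, 0)" | (raise) y where "x = raise y"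
  by (metis nat.exhaust raise_Pair surj_pair)

text \<open>A finite set of pairs has bounded second components. The second claim allows every
  \<open>M \<ge> N\<close>, so that two families can be summed up to a common bound.\<close>

lemma locfin_bound:
  fixes f :: "'n::finite \<times> nat \<Rightarrow> 'v mfps"
  assumes "locfin f"
  obtains N where "\<And>\<nu> k. k \<ge> N \<Longrightarrow> mcoeff (f (\<nu>, k)) m = 0"
    "\<And>M. M \<ge> N \<Longrightarrow> mcoeff (msum f) m = (\<Sum>\<nu>\<in>UNIV. \<Sum>k<M. mcoeff (f (\<nu>, k)) m)"
proof -
  let ?K = "{x. mcoeff (f x) m \<noteq> 0}"
  have "finite (snd ` ?K)" using assms by (simp add: locfin_def)
  then obtain N where N: "\<forall>k\<in>snd ` ?K. k < N" using finite_nat_set_iff_bounded by blast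
  have 0: "mcoeff (f (\<nu>, k)) m = 0" if "k \<ge> N" for \<nu> k
  proof (rule ccontr)
    assume "mcoeff (f (\<nu>, k)) m \<noteq> 0"
    then have "snd (\<nu>, k) \<in> snd ` ?K" by (intro imageI) simp
    then have "k < N" using N unfolding snd_conv by blast
    with that show False by simp
  qed
  show ?thesis
  proof (rule that[OF 0])
    fix M assume "M \<ge> N"
    have "mcoeff (msum f) m = (\<Sum>x\<in>UNIV \<times> {..<M}. mcoeff (f x) m)"
    proof (rule mcoeff_msum_superset)
      show "?K \<subseteq> UNIV \<times> {..<M}"
        using 0 \<open>M \<ge> N\<close> by (auto simp flip: not_le intro: order_trans)
    qed simp
    then show "mcoeff (msum f) m = (\<Sum>\<nu>\<in>UNIV. \<Sum>k<M. mcoeff (f (\<nu>, k)) m)"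
      by (subst sum.cartesian_product) (simp add: case_prod_unfold)
  qed
qed

text \<open>Separates level 0, where multiplication by z turns momenta into positions, from the
  higher levels, where it is a mere shift.\<close>

lemma msum_raise:
  fixes f :: "'n::finite \<times> nat \<Rightarrow> 'v mfps"
  assumes "locfin f"
  shows "msum f = (\<Sum>\<nu>\<in>UNIV. f (\<nu>, 0)) + msum (\<lambda>x. f (raise x))"
proof (rule mfps_eqI)
  fix m
  obtain N where N: "\<And>\<nu> k. k \<ge> N \<Longrightarrow> mcoeff (f (\<nu>, k)) m = 0"
    "\<And>M. M \<ge> N \<Longrightarrow> mcoeff (msum f) m = (\<Sum>\<nu>\<in>UNIV. \<Sum>k<M. mcoeff (f (\<nu>, k)) m)"
    by (rule locfin_bound[OF assms, where m = m]) (rule that)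
  obtain N' where N': "\<And>\<nu> k. k \<ge> N' \<Longrightarrow> mcoeff (f (raise (\<nu>, k))) m = 0"
    "\<And>M. M \<ge> N' \<Longrightarrow> mcoeff (msum (\<lambda>x. f (raise x))) m =
      (\<Sum>\<nu>\<in>UNIV. \<Sum>k<M. mcoeff (f (raise (\<nu>, k))) m)"
    by (rule locfin_bound[OF locfin_comp[OF assms inj_raise], where m = m]) (rule that)
  show "mcoeff (msum f) m = mcoeff ((\<Sum>\<nu>\<in>UNIV. f (\<nu>, 0)) + msum (\<lambda>x. f (raise x))) m"
    using N(2)[of "Suc (max N N')"] N'(2)[of "max N N'"]
    by (simp add: mcoeff_sum sum.lessThan_Suc_shift sum.distrib del: sum.lessThan_Suc)
qed

lemma msum_rows:
  fixes f :: "'n::finite \<times> nat \<Rightarrow> 'v mfps"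
  assumes "locfin f"
  shows "msum (\<lambda>k. \<Sum>\<nu>\<in>UNIV. f (\<nu>, k)) = msum f"
proof (rule mfps_eqI)
  fix m
  obtain N where N: "\<And>\<nu> k. k \<ge> N \<Longrightarrow> mcoeff (f (\<nu>, k)) m = 0"
    "\<And>M. M \<ge> N \<Longrightarrow> mcoeff (msum f) m = (\<Sum>\<nu>\<in>UNIV. \<Sum>k<M. mcoeff (f (\<nu>, k)) m)"
    by (rule locfin_bound[OF assms, where m = m]) (rule that)
  have "mcoeff (msum (\<lambda>k. \<Sum>\<nu>\<in>UNIV. f (\<nu>, k))) m = (\<Sum>k<N. mcoeff (\<Sum>\<nu>\<in>UNIV. f (\<nu>, k)) m)"
  proof (rule mcoeff_msum_superset)
    show "{k. mcoeff (\<Sum>\<nu>\<in>UNIV. f (\<nu>, k)) m \<noteq> 0} \<subseteq> {..<N}"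
      using N(1) by (auto simp: mcoeff_sum simp flip: not_le)
  qed simp
  also have "\<dots> = mcoeff (msum f) m"
    using N(2)[OF order_refl] by (simp add: mcoeff_sum) (rule sum.swap)
  finally show "mcoeff (msum (\<lambda>k. \<Sum>\<nu>\<in>UNIV. f (\<nu>, k))) m = mcoeff (msum f) m" .
qed

section \<open>Darboux coordinates on the loop space, and multiplication by z in terms of
  them\<close>

section \<open>Coordinates on the loop space\<close>

context pairing_space
begin

definition rep :: "'h \<Rightarrow> 'n \<Rightarrow> complex"
  where "rep x \<alpha> = representation (range \<phi>) x (\<phi> \<alpha>)"

lemma rep_simps [simp]:
  "rep 0 \<alpha> = 0"
  "rep (x + y) \<alpha> = rep x \<alpha> + rep y \<alpha>"
  "rep (- x) \<alpha> = - rep x \<alpha>"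
  "rep (scale c x) \<alpha> = c * rep x \<alpha>"
  by (simp_all add: rep_def independent_basis span_basis representation_zero representation_add
      representation_neg representation_scale)

lemma rep_sum: "rep (sum f A) \<alpha> = (\<Sum>i\<in>A. rep (f i) \<alpha>)"
  by (induction A rule: infinite_finite_induct) simp_all

lemma rep_basis: "rep (\<phi> \<alpha>) \<beta> = (if \<alpha> = \<beta> then 1 else 0)"
  using inj_basis by (auto simp: rep_def representation_basis independent_basis inj_eq)

lemma sum_rep: "(\<Sum>\<alpha>\<in>UNIV. scale (rep x \<alpha>) (\<phi> \<alpha>)) = x"
  using sum_representation_eq[OF independent_basis, of x "range \<phi>"]
  by (simp add: rep_def span_basis sum.reindex inj_basis)

lemma rep_combination [simp]: "rep (\<Sum>\<alpha>\<in>UNIV. scale (c \<alpha>) (\<phi> \<alpha>)) \<beta> = c \<beta>"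
  by (simp add: rep_sum rep_basis sum.delta if_distrib[of "(*) _"] cong: if_cong)

lemma pair_add_right: "pair x (y + z) = pair x y + pair x z"
  and pair_scale_right: "pair x (scale c y) = c * pair x y"
proof -
  have "module_hom scale (*) (pair x)"
    using pair_linear by (simp only: module_hom_iff_linear)
  then show "pair x (y + z) = pair x y + pair x z" "pair x (scale c y) = c * pair x y"
    by (rule module_hom.add, rule module_hom.scale)
qed

lemma pair_add_left: "pair (x + y) z = pair x z + pair y z"
  and pair_scale_left: "pair (scale c x) z = c * pair x z"
  by (simp_all only: pair_sym[of _ z] pair_add_right pair_scale_right)

lemma pair_0_right [simp]: "pair x 0 = 0"
  using pair_add_right[of x 0 0] by simp

lemma pair_0_left [simp]: "pair 0 x = 0"
  by (metis pair_0_right pair_sym)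

lemma pair_sum_left: "pair (sum f A) z = (\<Sum>i\<in>A. pair (f i) z)"
  by (induction A rule: infinite_finite_induct) (simp_all add: pair_add_left)

lemma pair_sum_right: "pair z (sum f A) = (\<Sum>i\<in>A. pair z (f i))"
  by (induction A rule: infinite_finite_induct) (simp_all add: pair_add_right)

lemma pair_expand_right: "pair x y = (\<Sum>\<alpha>\<in>UNIV. rep y \<alpha> * pair x (\<phi> \<alpha>))"
  by (subst sum_rep[of y, symmetric]) (simp only: pair_sum_right pair_scale_right)

lemma pair_expand_left: "pair x y = (\<Sum>\<alpha>\<in>UNIV. rep x \<alpha> * pair (\<phi> \<alpha>) y)"
  by (subst sum_rep[of x, symmetric]) (simp only: pair_sum_left pair_scale_left)

abbreviation ginv :: "'n \<Rightarrow> 'n \<Rightarrow> complex"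
  where "ginv \<mu> \<nu> \<equiv> matrix_inv gram $ \<mu> $ \<nu>"

lemma gram_inverse: "gram ** matrix_inv gram = mat 1" "matrix_inv gram ** gram = mat 1"
proof -
  have "x = 0" if "gram *v x = 0" for x
  proof -
    let ?v = "\<Sum>\<alpha>\<in>UNIV. scale (x $ \<alpha>) (\<phi> \<alpha>)"
    have "pair ?v y = 0" for y
    proof -
      have "pair ?v (\<phi> \<alpha>) = (gram *v x) $ \<alpha>" for \<alpha>
        by (simp add: matrix_vector_mult_def gram_def pair_sum_right pair_scale_right mult.commute
            pair_sym[of _ "\<phi> \<alpha>"])
      then show ?thesis using that by (simp add: pair_expand_right[of _ y])
    qed
    then have "?v = 0" by (rule pair_nondegenerate)
    then have "x $ \<alpha> = 0" for \<alpha> using rep_combination[of "\<lambda>\<alpha>. x $ \<alpha>" \<alpha>] by simp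
    then show "x = 0" by (simp add: vec_eq_iff)
  qed
  then have "invertible gram"
    by (simp add: invertible_left_inverse matrix_left_invertible_ker)
  then have "\<exists>B. gram ** B = mat 1 \<and> B ** gram = mat 1"
    unfolding invertible_def .
  then have "gram ** matrix_inv gram = mat 1 \<and> matrix_inv gram ** gram = mat 1"
    unfolding matrix_inv_def by (rule someI_ex)
  then show "gram ** matrix_inv gram = mat 1" "matrix_inv gram ** gram = mat 1" by auto
qed

lemma sum_gram_ginv: "(\<Sum>\<mu>\<in>UNIV. pair (\<phi> \<alpha>) (\<phi> \<mu>) * ginv \<mu> \<nu>) = (if \<alpha> = \<nu> then 1 else 0)"
  using arg_cong[OF gram_inverse(1), of "\<lambda>A. A $ \<alpha> $ \<nu>"]
  by (simp add: matrix_matrix_mult_def mat_def gram_def)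

lemma sum_ginv_gram: "(\<Sum>\<nu>\<in>UNIV. ginv \<mu> \<nu> * pair (\<phi> \<nu>) (\<phi> \<beta>)) = (if \<mu> = \<beta> then 1 else 0)"
  using arg_cong[OF gram_inverse(2), of "\<lambda>A. A $ \<mu> $ \<beta>"]
  by (simp add: matrix_matrix_mult_def mat_def gram_def)

lemma rep_eq_pair: "rep x \<nu> = (\<Sum>\<mu>\<in>UNIV. pair x (\<phi> \<mu>) * ginv \<mu> \<nu>)"
proof -
  have "(\<Sum>\<mu>\<in>UNIV. pair x (\<phi> \<mu>) * ginv \<mu> \<nu>) =
      (\<Sum>\<mu>\<in>UNIV. \<Sum>\<alpha>\<in>UNIV. rep x \<alpha> * (pair (\<phi> \<alpha>) (\<phi> \<mu>) * ginv \<mu> \<nu>))"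
    by (simp add: pair_expand_left[of x] sum_distrib_right mult.assoc)
  also have "\<dots> = (\<Sum>\<alpha>\<in>UNIV. rep x \<alpha> * (\<Sum>\<mu>\<in>UNIV. pair (\<phi> \<alpha>) (\<phi> \<mu>) * ginv \<mu> \<nu>))"
    unfolding sum_distrib_left by (rule sum.swap)
  also have "\<dots> = rep x \<nu>"
    by (simp add: sum_gram_ginv if_distrib[of "(*) _"] cong: if_cong)
  finally show ?thesis ..
qed

lemma eq_if_rep_eq: "(\<And>\<alpha>. rep x \<alpha> = rep y \<alpha>) \<Longrightarrow> x = y"
  by (metis (no_types, lifting) sum.cong sum_rep)

lemma eq_if_pair_eq: "(\<And>\<alpha>. pair x (\<phi> \<alpha>) = pair y (\<phi> \<alpha>)) \<Longrightarrow> x = y"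
  by (rule eq_if_rep_eq) (simp add: rep_eq_pair)

text \<open>The element with prescribed pairings \<open>c\<close> against the basis; it rebuilds the
  coefficients at negative powers of z from the p-coordinates.\<close>

definition dual_vector :: "('n \<Rightarrow> complex) \<Rightarrow> 'h"
  where "dual_vector c = (\<Sum>\<nu>\<in>UNIV. scale (\<Sum>\<mu>\<in>UNIV. c \<mu> * ginv \<mu> \<nu>) (\<phi> \<nu>))"

lemma pair_dual_vector: "pair (dual_vector c) (\<phi> \<beta>) = c \<beta>"
proof -
  have "pair (dual_vector c) (\<phi> \<beta>) = (\<Sum>\<nu>\<in>UNIV. \<Sum>\<mu>\<in>UNIV. c \<mu> * (ginv \<mu> \<nu> * pair (\<phi> \<nu>) (\<phi> \<beta>)))"
    by (simp add: dual_vector_def pair_sum_left pair_scale_left sum_distrib_right mult.assoc)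
  also have "\<dots> = (\<Sum>\<mu>\<in>UNIV. c \<mu> * (\<Sum>\<nu>\<in>UNIV. ginv \<mu> \<nu> * pair (\<phi> \<nu>) (\<phi> \<beta>)))"
    unfolding sum_distrib_left by (rule sum.swap)
  also have "\<dots> = c \<beta>"
    by (simp add: sum_ginv_gram if_distrib[of "(*) _"] cong: if_cong)
  finally show ?thesis .
qed

lemma mcoeff_q_coord: "mcoeff (q_coord f (\<alpha>, k)) m = rep (f m (int k)) \<alpha>"
  by (simp add: q_coord_def rep_def)

lemma neg_one_powi_neg: "(-1 :: complex) powi (- 1 - int k) = (-1) ^ Suc k"
proof -
  have "- 1 - int k = - int (Suc k)" by simp
  then show ?thesis by (simp only: power_int_minus power_int_of_nat) (simp flip: power_inverse)
qed

text \<open>Only the summand \<open>i = - 1 - int k\<close> of the residue survives, and the sign is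
  that of f(-z) at this power. It alternates in \<open>k\<close>, whence the minus sign when z
  shifts the p-coordinates.\<close>

lemma mcoeff_p_coord: "mcoeff (p_coord f (\<alpha>, k)) m = (-1) ^ Suc k * pair (f m (- 1 - int k)) (\<phi> \<alpha>)"
proof -
  have "\<Omega> (minus_part (f m)) (loop_monom (\<phi> \<alpha>) (int k)) =
      Sum_any (\<lambda>i. if i = - 1 - int k then (-1) powi i * pair (f m i) (\<phi> \<alpha>) else 0)"
    unfolding \<Omega>_def by (rule Sum_any.cong) (auto simp: minus_part_def loop_monom_def)
  also have "\<dots> = (-1) ^ Suc k * pair (f m (- 1 - int k)) (\<phi> \<alpha>)"
    by (simp only: Sum_any.delta neg_one_powi_neg)
  finally show ?thesis by (simp add: p_coord_def)
qed

text \<open>The q-coordinates determine the nonnegative powers of z and, by nondegeneracy, the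
  p-coordinates determine the negative ones. A single \<open>m\<close> is considered because
  conditions on base points concern \<open>m = 0\<close> only.\<close>

lemma family_eqI_at:
  assumes "\<And>x. mcoeff (q_coord f x) m = mcoeff (q_coord g x) m"
    and "\<And>x. mcoeff (p_coord f x) m = mcoeff (p_coord g x) m"
  shows "f m = g m"
proof
  fix i :: int
  show "f m i = g m i"
  proof (cases "i \<ge> 0")
    case True
    then have "rep (f m i) \<alpha> = rep (g m i) \<alpha>" for \<alpha>
      using assms(1)[of "(\<alpha>, nat i)"] by (simp add: mcoeff_q_coord)
    then show ?thesis by (rule eq_if_rep_eq)
  next
    case False
    then have i: "- 1 - int (nat (- 1 - i)) = i" by simp
    have "pair (f m i) (\<phi> \<alpha>) = pair (g m i) (\<phi> \<alpha>)" for \<alpha>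
      using assms(2)[of "(\<alpha>, nat (- 1 - i))"] unfolding mcoeff_p_coord i by simp
    then show ?thesis by (rule eq_if_pair_eq)
  qed
qed

lemma family_eqI:
  "(\<And>x. q_coord f x = q_coord g x) \<Longrightarrow> (\<And>x. p_coord f x = p_coord g x) \<Longrightarrow> f = g"
  by (rule ext, rule family_eqI_at) simp_all

lemma locfin_q_coord:
  assumes "f \<in> families"
  shows "locfin (q_coord f)"
  unfolding locfin_def
proof
  fix m
  obtain N where N: "\<forall>i>N. f m i = 0"
    using assms by (auto simp: families_def loop_space_def)
  have "{x. mcoeff (q_coord f x) m \<noteq> 0} \<subseteq> UNIV \<times> {..nat N}"
  proof
    fix x assume x: "x \<in> {x. mcoeff (q_coord f x) m \<noteq> 0}"
    obtain \<alpha> k where [simp]: "x = (\<alpha>, k)" by (cases x)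
    from x have "f m (int k) \<noteq> 0" by (auto simp: mcoeff_q_coord)
    then have "int k \<le> N" using N by force
    then show "x \<in> UNIV \<times> {..nat N}" by auto
  qed
  then show "finite {x. mcoeff (q_coord f x) m \<noteq> 0}" by (rule finite_subset) simp
qed

definition mk_family :: "('n \<times> nat \<Rightarrow> 'v mfps) \<Rightarrow> ('n \<times> nat \<Rightarrow> 'v mfps) \<Rightarrow> ('v, 'h) family"
  where "mk_family q p = (\<lambda>m i. if i \<ge> 0 then \<Sum>\<alpha>\<in>UNIV. scale (mcoeff (q (\<alpha>, nat i)) m) (\<phi> \<alpha>)
    else dual_vector (\<lambda>\<alpha>. (-1) ^ Suc (nat (- 1 - i)) * mcoeff (p (\<alpha>, nat (- 1 - i))) m))"

lemma q_coord_mk_family [simp]: "q_coord (mk_family q p) x = q x"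
  by (cases x) (auto intro!: mfps_eqI simp: mcoeff_q_coord mk_family_def)

lemma p_coord_mk_family [simp]: "p_coord (mk_family q p) x = p x"
proof (cases x)
  case (Pair \<alpha> k)
  have [simp]: "(-1) ^ k * ((-1) ^ k * c) = (c :: complex)" for c
    by (simp add: power_mult_distrib[symmetric] flip: mult.assoc)
  show ?thesis unfolding Pair
    by (rule mfps_eqI) (simp add: mcoeff_p_coord mk_family_def pair_dual_vector)
qed

text \<open>Elements of the loop space have powers of z bounded above and unrestricted below, so the
  finiteness condition falls on the q-coordinates.\<close>

lemma mk_family_in_families [simp]:
  assumes "locfin q"
  shows "mk_family q p \<in> families"
  unfolding families_def loop_space_def
proof (intro CollectI allI)
  fix m
  obtain N where "\<And>\<nu> k. k \<ge> N \<Longrightarrow> mcoeff (q (\<nu>, k)) m = 0"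
    by (rule locfin_bound[OF assms, where m = m]) (rule that)
  then have "\<forall>i>int N. mk_family q p m i = 0"
    by (auto simp: mk_family_def)
  then show "\<exists>N. \<forall>i>N. mk_family q p m i = 0" by blast
qed

lemma q_coord_scale_family: "q_coord (scale_family c f) x = c * q_coord f x"
  by (cases x) (auto intro!: mfps_eqI
      simp: mcoeff_q_coord scale_family_def rep_sum mcoeff_mult case_prod_unfold)

lemma p_coord_scale_family: "p_coord (scale_family c f) x = c * p_coord f x"
  by (cases x) (auto intro!: mfps_eqI simp: mcoeff_p_coord scale_family_def pair_sum_left
      pair_scale_left mcoeff_mult case_prod_unfold sum_distrib_left mult.left_commute sum_negf)

lemma scale_family_coords: "scale_family c f = mk_family (\<lambda>x. c * q_coord f x) (\<lambda>x. c * p_coord f x)"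
  by (rule family_eqI) (simp_all add: q_coord_scale_family p_coord_scale_family)

lemma zmult_in_families:
  assumes "f \<in> families"
  shows "zmult f \<in> families"
  unfolding families_def loop_space_def
proof (intro CollectI allI)
  fix m
  obtain N where "\<forall>i>N. f m i = 0" using assms by (auto simp: families_def loop_space_def)
  then have "\<forall>i>N + 1. zmult f m i = 0" by (simp add: zmult_def)
  then show "\<exists>N. \<forall>i>N. zmult f m i = 0" by blast
qed

lemma zmult_surj:
  assumes "f \<in> families"
  obtains w where "w \<in> families" "zmult w = f"
proof
  show "(\<lambda>m i. f m (i + 1)) \<in> families"
    unfolding families_def loop_space_def
  proof (intro CollectI allI)
    fix m
    obtain N where "\<forall>i>N. f m i = 0" using assms by (auto simp: families_def loop_space_def)
    then have "\<forall>i>N. f m (i + 1) = 0" by simp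
    then show "\<exists>N. \<forall>i>N. f m (i + 1) = 0" by blast
  qed
  show "zmult (\<lambda>m i. f m (i + 1)) = f" by (simp add: zmult_def)
qed

lemma q_coord_zmult_raise: "q_coord (zmult v) (raise x) = q_coord v x"
  by (cases x) (auto intro!: mfps_eqI simp: mcoeff_q_coord zmult_def)

text \<open>The coefficient of \<open>v\<close> at 1/z moves to the constant coefficient of z v: the
  only place where momenta become positions. The minus sign is that of the p-coordinates at level
  0.\<close>

lemma q_coord_zmult_0:
  "q_coord (zmult v) (\<nu>, 0) = - (\<Sum>\<mu>\<in>UNIV. mconst (ginv \<mu> \<nu>) * p_coord v (\<mu>, 0))"
  by (rule mfps_eqI) (simp add: mcoeff_q_coord zmult_def mcoeff_sum mcoeff_p_coord rep_eq_pair sum_negf mult.commute[of _ "ginv _ _"])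

lemma p_coord_zmult: "p_coord (zmult v) x = - p_coord v (raise x)"
  by (cases x) (auto intro!: mfps_eqI simp: mcoeff_p_coord zmult_def algebra_simps)

text \<open>The same coefficient read in the other direction, for use when z v is known and
  \<open>v\<close> is sought.\<close>

lemma p_coord_0_of_zmult: "p_coord v (\<alpha>, 0) = - (\<Sum>\<beta>\<in>UNIV. mconst (gram $ \<alpha> $ \<beta>) * q_coord (zmult v) (\<beta>, 0))"
proof (rule mfps_eqI)
  fix m
  have "pair (v m (- 1)) (\<phi> \<alpha>) = (\<Sum>\<beta>\<in>UNIV. rep (v m (- 1)) \<beta> * pair (\<phi> \<beta>) (\<phi> \<alpha>))"
    by (rule pair_expand_left)
  then show "mcoeff (p_coord v (\<alpha>, 0)) m = mcoeff (- (\<Sum>\<beta>\<in>UNIV. mconst (gram $ \<alpha> $ \<beta>) * q_coord (zmult v) (\<beta>, 0))) m"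
    by (simp add: mcoeff_q_coord zmult_def mcoeff_sum mcoeff_p_coord gram_def mult.commute pair_sym[of _ "\<phi> \<alpha>"])
qed

lemma \<Omega>_eq_sum:
  assumes "\<And>i. i \<ge> int n \<Longrightarrow> f i = 0" "\<And>i. i \<ge> int n \<Longrightarrow> g i = 0"
  shows "\<Omega> f g = (\<Sum>k<n. (-1) ^ Suc k * pair (f (- 1 - int k)) (g (int k)))
    - (\<Sum>k<n. (-1) ^ Suc k * pair (f (int k)) (g (- 1 - int k)))"
proof -
  let ?t = "\<lambda>i. (-1) powi i * pair (f i) (g (- 1 - i))"
  let ?neg = "(\<lambda>k. - 1 - int k) ` {..<n}" and ?pos = "int ` {..<n}"
  have "\<Omega> f g = sum ?t (?neg \<union> ?pos)"
    unfolding \<Omega>_def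
  proof (rule Sum_any.expand_superset)
    show "{i. ?t i \<noteq> 0} \<subseteq> ?neg \<union> ?pos"
    proof clarify
      fix i assume "?t i \<noteq> 0" "i \<notin> ?pos"
      then have nz: "f i \<noteq> 0" "g (- 1 - i) \<noteq> 0" by auto
      then have "i < int n" "- 1 - i < int n" using assms by (meson not_less)+
      moreover have "\<not> (0 \<le> i \<and> i < int n)"
        using \<open>i \<notin> ?pos\<close> by (metis imageI lessThan_iff nonneg_int_cases of_nat_less_iff)
      ultimately have "i = - 1 - int (nat (- 1 - i))" "nat (- 1 - i) < n" by auto
      then show "i \<in> ?neg" by blast
    qed
  qed simp
  also have "\<dots> = sum ?t ?neg + sum ?t ?pos"
    by (rule sum.union_disjoint) auto
  also have "sum ?t ?neg = (\<Sum>k<n. (-1) ^ Suc k * pair (f (- 1 - int k)) (g (int k)))"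
    by (subst sum.reindex) (auto simp: inj_on_def neg_one_powi_neg simp del: power_Suc)
  also have "sum ?t ?pos = - (\<Sum>k<n. (-1) ^ Suc k * pair (f (int k)) (g (- 1 - int k)))"
    by (subst sum.reindex) (auto simp: inj_on_def sum_negf)
  finally show ?thesis by simp
qed

text \<open>Darboux form of the symplectic form: the negative indices in the residue give the first
  sum, the nonnegative ones the second.\<close>

lemma \<Omega>_family_eq:
  fixes v w :: "('v, 'h) family"
  assumes v: "v \<in> families" and w: "w \<in> families"
  shows "\<Omega>_family v w =
    msum (\<lambda>x. p_coord v x * q_coord w x) - msum (\<lambda>x. p_coord w x * q_coord v x)"
proof (rule mfps_eqI)
  fix m
  \<comment> \<open>There are finitely many splittings of \<open>m\<close>, so the bounds on the
    powers of z in all coefficients involved admit a common one.\<close>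
  have "\<forall>p\<in>splits m. eventually (\<lambda>i. v (fst p) i = 0 \<and> w (snd p) i = 0 \<and> v (snd p) i = 0 \<and> w (fst p) i = 0) at_top"
    using v w by (auto simp: families_def loop_space_def eventually_conj_iff eventually_at_top_dense)
  then have "eventually (\<lambda>i. \<forall>p\<in>splits m. v (fst p) i = 0 \<and> w (snd p) i = 0 \<and> v (snd p) i = 0 \<and> w (fst p) i = 0) at_top"
    by (rule eventually_ball_finite[OF finite_splits])
  then obtain N where N: "\<forall>i\<ge>N. \<forall>p\<in>splits m. v (fst p) i = 0 \<and> w (snd p) i = 0 \<and> v (snd p) i = 0 \<and> w (fst p) i = 0"
    unfolding eventually_at_top_linorder by blast
  define n where "n = nat N"
  have n: "v a i = 0" "w b i = 0" "v b i = 0" "w a i = 0" if "(a, b) \<in> splits m" "i \<ge> int n" for a b i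
  proof -
    have "N \<le> i" using that(2) by (simp add: n_def split: if_splits)
    with N that(1) show "v a i = 0" "w b i = 0" "v b i = 0" "w a i = 0" by fastforce+
  qed
  let ?K = "(UNIV :: 'n set) \<times> {..<n}"
  have *: "mcoeff (msum (\<lambda>x. p_coord f x * q_coord g x)) m =
      (\<Sum>(a, b)\<in>splits m. \<Sum>k<n. (-1) ^ Suc k * pair (f a (- 1 - int k)) (g b (int k)))"
    if g: "\<And>a b i. (a, b) \<in> splits m \<Longrightarrow> i \<ge> int n \<Longrightarrow> g b i = 0" for f g :: "('v, 'h) family"
  proof -
    have "mcoeff (msum (\<lambda>x. p_coord f x * q_coord g x)) m = (\<Sum>x\<in>?K. mcoeff (p_coord f x * q_coord g x) m)"
    proof (rule mcoeff_msum_superset)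
      show "{x. mcoeff (p_coord f x * q_coord g x) m \<noteq> 0} \<subseteq> ?K"
      proof
        fix x assume x: "x \<in> {x. mcoeff (p_coord f x * q_coord g x) m \<noteq> 0}"
        obtain \<alpha> k where [simp]: "x = (\<alpha>, k)" by (cases x)
        from x have "mcoeff (p_coord f (\<alpha>, k) * q_coord g (\<alpha>, k)) m \<noteq> 0" by simp
        then obtain a b where "a + b = m" "mcoeff (q_coord g (\<alpha>, k)) b \<noteq> 0"
          by (rule mcoeff_mult_nonzero)
        then have "(a, b) \<in> splits m" "g b (int k) \<noteq> 0" by (auto simp: mcoeff_q_coord)
        then have "k < n" using g[of a b "int k"] by force
        then show "x \<in> ?K" by simp
      qed
    qed simp
    also have "\<dots> = (\<Sum>k<n. \<Sum>\<alpha>\<in>UNIV. mcoeff (p_coord f (\<alpha>, k) * q_coord g (\<alpha>, k)) m)"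
      unfolding sum.cartesian_product' by (rule sum.swap)
    also have "\<dots> = (\<Sum>k<n. \<Sum>\<alpha>\<in>UNIV. \<Sum>p\<in>splits m. (-1) ^ Suc k *
        (rep (g (snd p) (int k)) \<alpha> * pair (f (fst p) (- 1 - int k)) (\<phi> \<alpha>)))"
      by (simp only: mcoeff_mult mcoeff_q_coord mcoeff_p_coord case_prod_unfold ac_simps)
    also have "\<dots> = (\<Sum>k<n. \<Sum>p\<in>splits m. (-1) ^ Suc k * pair (f (fst p) (- 1 - int k)) (g (snd p) (int k)))"
      unfolding pair_expand_right[of _ "g _ _"] sum_distrib_left
      by (intro sum.cong refl) (rule sum.swap)
    also have "\<dots> = (\<Sum>(a, b)\<in>splits m. \<Sum>k<n. (-1) ^ Suc k * pair (f a (- 1 - int k)) (g b (int k)))"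
      unfolding case_prod_unfold by (rule sum.swap)
    finally show ?thesis .
  qed
  have "mcoeff (\<Omega>_family v w) m =
      (\<Sum>(a, b)\<in>splits m. (\<Sum>k<n. (-1) ^ Suc k * pair (v a (- 1 - int k)) (w b (int k)))
        - (\<Sum>k<n. (-1) ^ Suc k * pair (v a (int k)) (w b (- 1 - int k))))"
    unfolding \<Omega>_family_def mcoeff_MFPS
  proof (intro sum.cong refl, clarify)
    fix a b assume "(a, b) \<in> splits m"
    then show "\<Omega> (v a) (w b) = (\<Sum>k<n. (-1) ^ Suc k * pair (v a (- 1 - int k)) (w b (int k)))
        - (\<Sum>k<n. (-1) ^ Suc k * pair (v a (int k)) (w b (- 1 - int k)))"
      using n by (intro \<Omega>_eq_sum) auto
  qed
  also have "\<dots> = (\<Sum>(a, b)\<in>splits m. \<Sum>k<n. (-1) ^ Suc k * pair (v a (- 1 - int k)) (w b (int k)))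
      - (\<Sum>(a, b)\<in>splits m. \<Sum>k<n. (-1) ^ Suc k * pair (w b (- 1 - int k)) (v a (int k)))"
    by (simp add: case_prod_unfold sum_subtractf pair_sym[of "v _ (int _)"] del: power_Suc)
  also have "(\<Sum>(a, b)\<in>splits m. \<Sum>k<n. (-1) ^ Suc k * pair (w b (- 1 - int k)) (v a (int k))) =
      (\<Sum>(a, b)\<in>splits m. \<Sum>k<n. (-1) ^ Suc k * pair (w a (- 1 - int k)) (v b (int k)))"
    by (rule sum.reindex_bij_witness[of _ prod.swap prod.swap]) (auto simp: add.commute)
  finally show "mcoeff (\<Omega>_family v w) m =
      mcoeff (msum (\<lambda>x. p_coord v x * q_coord w x) - msum (\<lambda>x. p_coord w x * q_coord v x)) m"
    using *[of w v] *[of v w] n by simp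
qed


section \<open>Equations, germ and tangent spaces in dilaton-shifted coordinates\<close>

section \<open>The equations in dilaton-shifted coordinates\<close>

abbreviation hess :: "('n \<times> nat) mfps \<Rightarrow> 'n \<times> nat \<Rightarrow> 'n \<times> nat \<Rightarrow> ('n \<times> nat) mfps"
  where "hess F x y \<equiv> pd x (pd y F)"

text \<open>The coordinates q = t - z as power series in t; the 1 subtracted at
  \<open>(e, 1)\<close> is the dilaton shift.\<close>

definition qvar :: "'n \<times> nat \<Rightarrow> ('n \<times> nat) mfps"
  where "qvar x = mvar x - (if x = (e, 1) then 1 else 0)"

lemma locfin_qvar: "locfin qvar"
  unfolding qvar_def by (intro locfin_diff locfin_mvar) (rule locfin_delta)

lemma locfin_qvar_raise: "locfin (\<lambda>x. qvar (raise x))"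
  by (rule locfin_comp[OF locfin_qvar inj_raise])

lemma qvar_0 [simp]: "qvar (\<alpha>, 0) = mvar (\<alpha>, 0)"
  by (simp add: qvar_def)

lemma pd_qvar: "pd x (qvar y) = (if x = y then 1 else 0)"
  by (simp add: qvar_def pd_diff pd_mvar)

lemma mcoeff_qvar_0: "mcoeff (qvar x) 0 = (if x = (e, 1) then - 1 else 0)"
  by (simp add: qvar_def mcoeff_mvar mcoeff_one)

text \<open>At t = 0 the only nonzero q-coordinate is the one at \<open>(e, 1)\<close>, with value
  -1.\<close>

lemma mcoeff_msum_qvar_0: "mcoeff (msum (\<lambda>x. qvar x * G x)) 0 = - mcoeff (G (e, 1)) 0"
proof -
  have "mcoeff (msum (\<lambda>x. qvar x * G x)) 0 = (\<Sum>x\<in>{(e, 1)}. mcoeff (qvar x * G x) 0)"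
    by (rule mcoeff_msum_superset) (auto simp: mcoeff_mult_0 mcoeff_qvar_0 split: if_splits)
  then show ?thesis by (simp add: mcoeff_mult_0 mcoeff_qvar_0)
qed

lemma mcoeff_msum_qvar_raise_0: "mcoeff (msum (\<lambda>x. qvar (raise x) * G x)) 0 = - mcoeff (G (e, 0)) 0"
proof -
  have "mcoeff (msum (\<lambda>x. qvar (raise x) * G x)) 0 = (\<Sum>x\<in>{(e, 0)}. mcoeff (qvar (raise x) * G x) 0)"
    by (rule mcoeff_msum_superset) (auto simp: mcoeff_mult_0 mcoeff_qvar_0 raise_def split: if_splits)
  then show ?thesis by (simp add: mcoeff_mult_0 mcoeff_qvar_0)
qed

lemma mcoeff_two_mult: "mcoeff (2 * F) m = 2 * mcoeff F m"
  by (simp only: mult_2 mcoeff_simps)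

text \<open>The shift absorbs the left-hand side of the dilaton equation into the Euler field, so
  the equation says that \<open>F\<close> is homogeneous of degree 2 in q.\<close>

definition euler :: "('n \<times> nat) mfps \<Rightarrow> ('n \<times> nat) mfps"
  where "euler F = msum (\<lambda>x. qvar x * pd x F) - 2 * F"

text \<open>With q in place of t, the derivative along the unit joins the sum as its term at
  \<open>(e, 0)\<close>, since \<open>qvar (e, 1)\<close> contains -1.\<close>

definition string :: "('n \<times> nat) mfps \<Rightarrow> ('n \<times> nat) mfps"
  where "string F =
    mconst (1/2) * (\<Sum>\<alpha>\<in>UNIV. \<Sum>\<beta>\<in>UNIV. mconst (gram $ \<alpha> $ \<beta>) * mvar (\<alpha>, 0) * mvar (\<beta>, 0))
    + msum (\<lambda>x. qvar (raise x) * pd x F)"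

lemma DE_iff_euler: "DE F \<longleftrightarrow> euler F = 0"
proof -
  have 1: "msum (\<lambda>n. \<Sum>\<nu>\<in>UNIV. mvar (\<nu>, n) * pd (\<nu>, n) F) = msum (\<lambda>x. mvar x * pd x F)"
    by (rule msum_rows[of "\<lambda>x. mvar x * pd x F"]) (intro locfin_mult' locfin_mvar)
  have "msum (\<lambda>x. qvar x * pd x F) =
      msum (\<lambda>x. mvar x * pd x F - (if x = (e, 1) then pd x F else 0))"
    by (rule arg_cong[of _ _ msum]) (auto simp: qvar_def algebra_simps)
  also have "\<dots> = msum (\<lambda>x. mvar x * pd x F) - pd (e, 1) F"
    by (subst msum_diff) (auto intro: locfin_mult' locfin_mvar)
  finally have 2: "msum (\<lambda>x. qvar x * pd x F) = msum (\<lambda>x. mvar x * pd x F) - pd (e, 1) F" .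
  have "a = m - b \<longleftrightarrow> m - a - b = 0" for a b m :: "('n \<times> nat) mfps"
    by (auto simp: algebra_simps)
  then show ?thesis
    unfolding DE_def euler_def 1 2 .
qed

lemma SE_iff_string: "SE F \<longleftrightarrow> string F = 0"
proof -
  have lf: "locfin (\<lambda>x. mvar (raise x) * pd x F)"
    by (intro locfin_mult' locfin_comp[OF locfin_mvar inj_raise])
  have 1: "msum (\<lambda>n. \<Sum>\<nu>\<in>UNIV. mvar (\<nu>, n + 1) * pd (\<nu>, n) F) = msum (\<lambda>x. mvar (raise x) * pd x F)"
    using msum_rows[OF lf] by simp
  have "msum (\<lambda>x. qvar (raise x) * pd x F) =
      msum (\<lambda>x. mvar (raise x) * pd x F - (if x = (e, 0) then pd x F else 0))"
    by (rule arg_cong[of _ _ msum]) (auto simp: qvar_def raise_def algebra_simps)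
  also have "\<dots> = msum (\<lambda>x. mvar (raise x) * pd x F) - pd (e, 0) F"
    using lf by (subst msum_diff) auto
  finally have 2: "msum (\<lambda>x. qvar (raise x) * pd x F) = msum (\<lambda>x. mvar (raise x) * pd x F) - pd (e, 0) F" .
  have "a = b + m \<longleftrightarrow> b + (m - a) = 0" for a b m :: "('n \<times> nat) mfps"
    by (auto simp: algebra_simps)
  then show ?thesis
    unfolding SE_def string_def 1 2 .
qed

lemma TRR_iff: "TRR F \<longleftrightarrow> (\<forall>x y z. pd (raise x) (hess F y z) =
    (\<Sum>\<mu>\<in>UNIV. \<Sum>\<nu>\<in>UNIV. hess F x (\<mu>, 0) * mconst (ginv \<mu> \<nu>) * pd (\<nu>, 0) (hess F y z)))"
  by (auto simp: TRR_def raise_def)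

lemma pd_euler: "pd x (euler F) = msum (\<lambda>y. qvar y * hess F x y) - pd x F"
proof -
  have "pd x (msum (\<lambda>y. qvar y * pd y F)) =
      msum (\<lambda>y. (if y = x then pd y F else 0) + qvar y * hess F x y)"
    unfolding pd_msum by (rule arg_cong[of _ _ msum]) (auto simp: pd_mult pd_qvar)
  also have "\<dots> = pd x F + msum (\<lambda>y. qvar y * hess F x y)"
    by (subst msum_add) (auto intro: locfin_mult' locfin_qvar)
  finally show ?thesis
    by (simp only: euler_def pd_diff mult_2 pd_add) simp
qed

lemma pd_raise_msum_qvar:
  "pd (raise x) (msum (\<lambda>y. qvar (raise y) * G y)) = G x + msum (\<lambda>y. qvar (raise y) * pd (raise x) (G y))"
proof -
  have "pd (raise x) (msum (\<lambda>y. qvar (raise y) * G y)) =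
      msum (\<lambda>y. (if y = x then G y else 0) + qvar (raise y) * pd (raise x) (G y))"
    unfolding pd_msum by (rule arg_cong[of _ _ msum]) (auto simp: pd_mult pd_qvar)
  also have "\<dots> = G x + msum (\<lambda>y. qvar (raise y) * pd (raise x) (G y))"
    by (subst msum_add) (auto intro: locfin_mult' locfin_qvar_raise)
  finally show ?thesis .
qed

lemma pd_string_raise: "pd (raise x) (string F) = pd x F + msum (\<lambda>y. qvar (raise y) * hess F (raise x) y)"
  by (simp add: string_def pd_add pd_mult pd_sum pd_mvar pd_raise_msum_qvar)

lemma pd_string_0: "pd (\<alpha>, 0) (string F) =
    (\<Sum>\<beta>\<in>UNIV. mconst (gram $ \<alpha> $ \<beta>) * mvar (\<beta>, 0)) + msum (\<lambda>y. qvar (raise y) * hess F (\<alpha>, 0) y)"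
proof -
  let ?q = "\<Sum>\<beta>\<in>UNIV. mconst (gram $ \<alpha> $ \<beta>) * mvar (\<beta>, 0::nat)"
  have "pd (\<alpha>, 0::nat) (\<Sum>\<gamma>\<in>UNIV. \<Sum>\<beta>\<in>UNIV. mconst (gram $ \<gamma> $ \<beta>) * mvar (\<gamma>, 0) * mvar (\<beta>, 0)) =
     (\<Sum>\<gamma>\<in>UNIV. \<Sum>\<beta>\<in>UNIV. (if \<gamma> = \<alpha> then mconst (gram $ \<gamma> $ \<beta>) * mvar (\<beta>, 0) else 0)
        + (if \<beta> = \<alpha> then mconst (gram $ \<gamma> $ \<beta>) * mvar (\<gamma>, 0) else 0))"
    unfolding pd_sum by (intro sum.cong refl) (auto simp: pd_mult pd_mvar)
  also have "\<dots> = (\<Sum>\<gamma>\<in>UNIV. (if \<gamma> = \<alpha> then (\<Sum>\<beta>\<in>UNIV. mconst (gram $ \<gamma> $ \<beta>) * mvar (\<beta>, 0)) else 0)) +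
      (\<Sum>\<gamma>\<in>UNIV. mconst (gram $ \<gamma> $ \<alpha>) * mvar (\<gamma>, 0))"
    unfolding sum.distrib by (intro arg_cong2[of _ _ _ _ "(+)"] sum.cong refl) auto
  also have "\<dots> = ?q + ?q"
    by (simp add: gram_def pair_sym[of "\<phi> _" "\<phi> \<alpha>"])
  finally have "pd (\<alpha>, 0::nat) (mconst (1/2) *
      (\<Sum>\<gamma>\<in>UNIV. \<Sum>\<beta>\<in>UNIV. mconst (gram $ \<gamma> $ \<beta>) * mvar (\<gamma>, 0) * mvar (\<beta>, 0))) = mconst (1/2) * (?q + ?q)"
    by (simp only: pd_mult pd_mconst mult_zero_left add_0_left)
  also have "\<dots> = ?q" by (rule mfps_eqI) (simp add: mcoeff_two_mult)
  finally have *: "pd (\<alpha>, 0::nat) (mconst (1/2) *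
      (\<Sum>\<gamma>\<in>UNIV. \<Sum>\<beta>\<in>UNIV. mconst (gram $ \<gamma> $ \<beta>) * mvar (\<gamma>, 0) * mvar (\<beta>, 0))) = ?q" .
  have "pd (\<alpha>, 0) (msum (\<lambda>y. qvar (raise y) * pd y F)) = msum (\<lambda>y. qvar (raise y) * hess F (\<alpha>, 0) y)"
    by (simp add: pd_msum pd_mult pd_qvar)
  with * show ?thesis by (simp add: string_def pd_add)
qed

text \<open>
  The string vector field \<open>D\<close>, applied to the Hessian, lowers an index up to sign. Hence the two ways
  of evaluating \<open>D\<close> on an entry with both indices raised, directly and after the topological recursion
  relation has extracted one index, yield the integrated form of the latter.
\<close>

lemma two_point_relation:
  assumes trr: "TRR F" and str: "string F = 0"
  shows "hess F (raise x) y + hess F x (raise y) =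
    (\<Sum>\<mu>\<in>UNIV. \<Sum>\<nu>\<in>UNIV. hess F x (\<mu>, 0) * mconst (ginv \<mu> \<nu>) * hess F (\<nu>, 0) y)"
proof -
  let ?D = "\<lambda>z. msum (\<lambda>u. qvar (raise u) * pd (raise y) (hess F z u))"
  have "pd (raise y) (pd (raise x) (string F)) = 0" using str by simp
  then have 1: "hess F (raise y) x + (hess F (raise x) y + ?D (raise x)) = 0"
    by (simp only: pd_string_raise pd_add pd_raise_msum_qvar)
  \<comment> \<open>The quadratic term of \<open>string F\<close> does not contribute: its
    derivative in \<open>(\<nu>, 0)\<close> involves variables of level 0 only, which
    \<open>pd (raise y)\<close> kills.\<close>
  have 2: "?D (\<nu>, 0) = - hess F (\<nu>, 0) y" for \<nu>
  proof -
    have "pd (raise y) (pd (\<nu>, 0) (string F)) = 0" using str by simp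
    then have "hess F (\<nu>, 0) y + ?D (\<nu>, 0) = 0"
      by (simp add: pd_string_0 pd_add pd_raise_msum_qvar pd_sum pd_mult pd_mvar)
    then show ?thesis by (simp add: eq_neg_iff_add_eq_0 add.commute)
  qed
  have "?D (raise x) = msum (\<lambda>u. \<Sum>\<mu>\<in>UNIV. \<Sum>\<nu>\<in>UNIV. hess F x (\<mu>, 0) * mconst (ginv \<mu> \<nu>) *
      (qvar (raise u) * pd (raise y) (hess F (\<nu>, 0) u)))"
  proof (rule arg_cong[of _ _ msum], rule ext)
    fix u
    have "pd (raise y) (hess F (raise x) u) = pd (raise x) (hess F (raise y) u)"
      by (rule pd_commute)
    also have "\<dots> = (\<Sum>\<mu>\<in>UNIV. \<Sum>\<nu>\<in>UNIV. hess F x (\<mu>, 0) * mconst (ginv \<mu> \<nu>) * pd (\<nu>, 0) (hess F (raise y) u))"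
      using trr unfolding TRR_iff by blast
    also have "\<dots> = (\<Sum>\<mu>\<in>UNIV. \<Sum>\<nu>\<in>UNIV. hess F x (\<mu>, 0) * mconst (ginv \<mu> \<nu>) * pd (raise y) (hess F (\<nu>, 0) u))"
      by (simp only: pd_commute[of "(_, 0)" "raise y"])
    finally show "qvar (raise u) * pd (raise y) (hess F (raise x) u) = (\<Sum>\<mu>\<in>UNIV. \<Sum>\<nu>\<in>UNIV.
        hess F x (\<mu>, 0) * mconst (ginv \<mu> \<nu>) * (qvar (raise u) * pd (raise y) (hess F (\<nu>, 0) u)))"
      by (simp only: sum_distrib_left mult.left_commute[of "qvar (raise u)"])
  qed
  also have "\<dots> = (\<Sum>\<mu>\<in>UNIV. \<Sum>\<nu>\<in>UNIV. hess F x (\<mu>, 0) * mconst (ginv \<mu> \<nu>) * ?D (\<nu>, 0))"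
    by (simp add: msum_sum msum_mult_left locfin_sum locfin_mult locfin_mult' locfin_qvar_raise)
  also have "\<dots> = - (\<Sum>\<mu>\<in>UNIV. \<Sum>\<nu>\<in>UNIV. hess F x (\<mu>, 0) * mconst (ginv \<mu> \<nu>) * hess F (\<nu>, 0) y)"
    by (simp add: 2 sum_negf)
  finally have 3: "?D (raise x) =
      - (\<Sum>\<mu>\<in>UNIV. \<Sum>\<nu>\<in>UNIV. hess F x (\<mu>, 0) * mconst (ginv \<mu> \<nu>) * hess F (\<nu>, 0) y)" .
  have "a + (b + - s) = 0 \<Longrightarrow> b + a = s" for a b s :: "('n \<times> nat) mfps"
    by (simp add: algebra_simps)
  from this[OF 1[unfolded 3]] show ?thesis
    unfolding pd_commute[of "raise y" x] .
qed

section \<open>The germ and its tangent spaces\<close>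

text \<open>Separated from \<open>germ\<close> so that substitution along \<open>t_coord\<close> is
  available for a family not yet known to lie on the germ, such as a point of z T.\<close>

definition based :: "('v, 'h) family \<Rightarrow> bool"
  where "based f \<longleftrightarrow> f \<in> families \<and> (\<forall>i\<ge>0. f 0 i = loop_monom (- unit) 1 i)"

lemma germ_iff: "f \<in> germ F \<longleftrightarrow> based f \<and> (\<forall>x. p_coord f x = msubst (pd x F) (t_coord f))"
  by (auto simp: germ_def based_def)

lemma germ_based: "f \<in> germ F \<Longrightarrow> based f"
  and p_coord_germ: "f \<in> germ F \<Longrightarrow> p_coord f x = msubst (pd x F) (t_coord f)"
  unfolding germ_iff by blast+

lemma rep_base_point: "rep (loop_monom (- unit) 1 (int k)) \<alpha> = (if (\<alpha>, k) = (e, 1) then - 1 else 0)"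
  by (auto simp: loop_monom_def rep_basis simp flip: basis_unit)

lemma admissible_t_coord:
  assumes "based f"
  shows "admissible (t_coord f)"
  unfolding admissible_def
proof (intro conjI allI)
  show "locfin (t_coord f)"
    unfolding t_coord_def using assms
    by (intro locfin_add locfin_q_coord) (auto simp: based_def intro: locfin_delta)
next
  fix x :: "'n \<times> nat"
  obtain \<alpha> k where "x = (\<alpha>, k)" by (cases x)
  then show "mcoeff (t_coord f x) 0 = 0"
    using assms rep_base_point[of k \<alpha>] by (auto simp: t_coord_def based_def mcoeff_q_coord mcoeff_one)
qed

definition hess_at :: "('n \<times> nat) mfps \<Rightarrow> ('v, 'h) family \<Rightarrow> 'n \<times> nat \<Rightarrow> 'n \<times> nat \<Rightarrow> 'v mfps"
  where "hess_at F f x y = msubst (hess F x y) (t_coord f)"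

lemma hess_at_sym: "hess_at F f x y = hess_at F f y x"
  by (simp add: hess_at_def pd_commute[of x y])

lemma tangent_iff: "v \<in> tangent F f \<longleftrightarrow>
    v \<in> families \<and> (\<forall>x. p_coord v x = msum (\<lambda>y. hess_at F f x y * q_coord v y))"
  by (simp add: tangent_def hess_at_def)

lemma tangent_families: "v \<in> tangent F f \<Longrightarrow> v \<in> families"
  and p_coord_tangent: "v \<in> tangent F f \<Longrightarrow> p_coord v x = msum (\<lambda>y. hess_at F f x y * q_coord v y)"
  unfolding tangent_iff by blast+

text \<open>The tangent vector over the basis vector with index \<open>x\<close> of the positive
  part. Its p-coordinates form column \<open>x\<close> of the Hessian, so its membership in another
  tangent space compares two Hessians.\<close>

definition tangent_basis :: "('n \<times> nat) mfps \<Rightarrow> ('v, 'h) family \<Rightarrow> 'n \<times> nat \<Rightarrow> ('v, 'h) family"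
  where "tangent_basis F f x = mk_family (\<lambda>y. if y = x then 1 else 0) (\<lambda>y. hess_at F f y x)"

lemma msum_mult_delta: "msum (\<lambda>y. g y * (if y = x then 1 else 0)) = g x"
proof -
  have "msum (\<lambda>y. g y * (if y = x then 1 else 0)) = msum (\<lambda>y. if y = x then g y else 0)"
    by (rule arg_cong[of _ _ msum]) auto
  then show ?thesis by simp
qed

lemma tangent_basis_in_tangent: "tangent_basis F f x \<in> tangent F f"
  by (simp add: tangent_iff tangent_basis_def msum_mult_delta)

text \<open>Isotropy is the symmetry of the Hessian. Conversely, a zero pairing with
  \<open>tangent_basis F f x\<close> forces the p-coordinate at \<open>x\<close> to be the one
  prescribed by the Hessian.\<close>

lemma Lagrangian_tangent: "Lagrangian (tangent F f)"
  unfolding Lagrangian_def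
proof (intro set_eqI iffI CollectI conjI ballI)
  fix v assume v: "v \<in> tangent F f"
  then show "v \<in> families" by (simp add: tangent_iff)
  fix w assume w: "w \<in> tangent F f"
  have "\<Omega>_family v w = msum (\<lambda>x. msum (\<lambda>y. hess_at F f x y * q_coord v y) * q_coord w x)
      - msum (\<lambda>x. msum (\<lambda>y. hess_at F f x y * q_coord w y) * q_coord v x)"
    by (simp add: \<Omega>_family_eq[OF v[THEN tangent_families] w[THEN tangent_families]]
        p_coord_tangent[OF v] p_coord_tangent[OF w])
  also have "\<dots> = 0"
    using msum_swap[OF locfin_q_coord[OF w[THEN tangent_families]]
        locfin_q_coord[OF v[THEN tangent_families]], of "hess_at F f"]
    by (simp add: hess_at_sym)
  finally show "\<Omega>_family v w = 0" .
next
  fix v assume "v \<in> {v \<in> families. \<forall>w\<in>tangent F f. \<Omega>_family v w = 0}"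
  then have v: "v \<in> families" and *: "\<Omega>_family v w = 0" if "w \<in> tangent F f" for w
    using that by auto
  show "v \<in> tangent F f"
    unfolding tangent_iff
  proof (intro conjI allI)
    show "v \<in> families" by (rule v[OF tangent_basis_in_tangent])
    fix x
    have "p_coord v x - msum (\<lambda>y. hess_at F f y x * q_coord v y) = 0"
      using *[OF tangent_basis_in_tangent, of x]
      unfolding \<Omega>_family_eq[OF \<open>v \<in> families\<close> tangent_families[OF tangent_basis_in_tangent]]
      by (simp add: tangent_basis_def msum_mult_delta)
    then show "p_coord v x = msum (\<lambda>y. hess_at F f x y * q_coord v y)"
      by (simp add: hess_at_sym[of F f x])
  qed
qed

text \<open>The coefficients \<open>a\<close> and \<open>b\<close> are power series in the
  parameters, which makes it possible to multiply a displacement by a parameter.\<close>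

lemma combination_in_tangent:
  assumes "v \<in> tangent F f" "w \<in> tangent F f"
  shows "mk_family (\<lambda>x. a * q_coord v x + b * q_coord w x) (\<lambda>x. a * p_coord v x + b * p_coord w x)
    \<in> tangent F f"
proof -
  have v: "locfin (q_coord v)" "locfin (q_coord w)"
    using assms by (auto simp: tangent_iff intro: locfin_q_coord)
  have "msum (\<lambda>y. hess_at F f x y * (a * q_coord v y + b * q_coord w y)) =
      a * msum (\<lambda>y. hess_at F f x y * q_coord v y) + b * msum (\<lambda>y. hess_at F f x y * q_coord w y)" for x
    using v by (simp add: distrib_left msum_add msum_mult_left locfin_mult mult.left_commute[of _ a]
        mult.left_commute[of _ b])
  then show ?thesis
    using assms v by (auto simp: tangent_iff intro!: mk_family_in_families locfin_add locfin_mult)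
qed

lemma scale_family_in_tangent: "v \<in> tangent F f \<Longrightarrow> scale_family c v \<in> tangent F f"
  using combination_in_tangent[of v F f v c 0] by (simp add: scale_family_coords)

lemma zmult_scale_family: "zmult (scale_family c v) = scale_family c (zmult v)"
  by (simp add: zmult_def scale_family_def)

lemma zmult_combination:
  "q_coord (zmult (mk_family (\<lambda>x. a * q_coord v x + b * q_coord w x) (\<lambda>x. a * p_coord v x + b * p_coord w x))) y =
    a * q_coord (zmult v) y + b * q_coord (zmult w) y"
  "p_coord (zmult (mk_family (\<lambda>x. a * q_coord v x + b * q_coord w x) (\<lambda>x. a * p_coord v x + b * p_coord w x))) y =
    a * p_coord (zmult v) y + b * p_coord (zmult w) y"
proof -
  show "q_coord (zmult (mk_family (\<lambda>x. a * q_coord v x + b * q_coord w x) (\<lambda>x. a * p_coord v x + b * p_coord w x))) y =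
    a * q_coord (zmult v) y + b * q_coord (zmult w) y"
  proof (cases y rule: coord_cases)
    case (zero \<alpha>)
    have "mconst c * (a * s + b * t) = a * (mconst c * s) + b * (mconst c * t)" for c s t
      by (simp add: algebra_simps)
    then show ?thesis unfolding zero
      by (simp add: q_coord_zmult_0 sum.distrib sum_distrib_left)
  qed (simp add: q_coord_zmult_raise)
qed (simp add: p_coord_zmult)

section \<open>Stability of tangent spaces under z, and constancy of the Hessian along z T\<close>

section \<open>From the equations to the geometry\<close>

lemma msubst_qvar: "based f \<Longrightarrow> msubst (qvar x) (t_coord f) = q_coord f x"
proof -
  assume "based f"
  then have "msubst (qvar x) (t_coord f) = t_coord f x - msubst (mconst (if x = (e, 1) then 1 else 0)) (t_coord f)"
    unfolding qvar_def by (subst msubst_diff[OF admissible_t_coord]) auto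
  then show ?thesis by (simp add: t_coord_def)
qed

text \<open>For \<open>f\<close> in the germ and \<open>w\<close> with z w = f, the two parts are
  the tangency conditions on \<open>w\<close> at level 0 and at higher levels. At any family over
  the base point the second part also computes dF from the Hessian.\<close>

lemma string_at:
  assumes "string F = 0" "based f"
  shows "(\<Sum>\<beta>\<in>UNIV. mconst (gram $ \<alpha> $ \<beta>) * q_coord f (\<beta>, 0))
      + msum (\<lambda>y. hess_at F f (\<alpha>, 0) y * q_coord f (raise y)) = 0" (is ?A)
    and "msubst (pd x F) (t_coord f) + msum (\<lambda>y. hess_at F f (raise x) y * q_coord f (raise y)) = 0" (is ?B)
proof -
  note adm = admissible_t_coord[OF assms(2)]
  have *: "msubst (msum (\<lambda>y. qvar (raise y) * hess F z y)) (t_coord f) =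
      msum (\<lambda>y. hess_at F f z y * q_coord f (raise y))" for z
    using assms(2) by (subst msubst_msum[OF adm locfin_mult'[OF locfin_qvar_raise]])
      (simp add: msubst_mult[OF adm] msubst_qvar hess_at_def mult.commute)
  have t0: "t_coord f (\<beta>, 0) = q_coord f (\<beta>, 0)" for \<beta>
    by (simp add: t_coord_def)
  have "msubst (pd (\<alpha>, 0) (string F)) (t_coord f) = 0" using assms(1) by simp
  then show ?A
    by (simp add: pd_string_0 msubst_add[OF adm] msubst_sum[OF adm] msubst_mult[OF adm] * t0)
  have "msubst (pd (raise x) (string F)) (t_coord f) = 0" using assms(1) by simp
  then show ?B
    by (simp add: pd_string_raise msubst_add[OF adm] *)
qed

text \<open>With p = H q, the condition on z v is \<open>two_point_relation\<close> pulled back to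
  \<open>f\<close>; its quadratic term comes from the momenta of \<open>v\<close> that become the
  level-0 positions of z v.\<close>

lemma zmult_tangent:
  assumes "TRR F" "string F = 0" "based f" "v \<in> tangent F f"
  shows "zmult v \<in> tangent F f"
  unfolding tangent_iff
proof (intro conjI allI)
  note adm = admissible_t_coord[OF assms(3)]
  have v: "v \<in> families" and p: "\<And>x. p_coord v x = msum (\<lambda>y. hess_at F f x y * q_coord v y)"
    using assms(4) by (auto simp: tangent_iff)
  show "zmult v \<in> families" by (rule zmult_in_families[OF v])
  fix x
  let ?h = "hess_at F f" and ?q = "q_coord v"
  note lf = locfin_q_coord[OF v]
  have tp: "?h x (raise y) - (\<Sum>\<nu>\<in>UNIV. \<Sum>\<mu>\<in>UNIV. ?h x (\<nu>, 0) * mconst (ginv \<mu> \<nu>) * ?h (\<mu>, 0) y) = - ?h (raise x) y" for y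
  proof -
    have "?h (raise y) x + ?h y (raise x) =
        (\<Sum>\<mu>\<in>UNIV. \<Sum>\<nu>\<in>UNIV. ?h y (\<mu>, 0) * mconst (ginv \<mu> \<nu>) * ?h (\<nu>, 0) x)"
      using arg_cong[OF two_point_relation[OF assms(1,2), of y x], of "\<lambda>g. msubst g (t_coord f)"]
      by (simp add: hess_at_def msubst_add[OF adm] msubst_sum[OF adm] msubst_mult[OF adm])
    also have "\<dots> = (\<Sum>\<nu>\<in>UNIV. \<Sum>\<mu>\<in>UNIV. ?h x (\<nu>, 0) * mconst (ginv \<mu> \<nu>) * ?h (\<mu>, 0) y)"
      by (subst sum.swap) (simp only: hess_at_sym[of F f y] hess_at_sym[of F f _ x] ac_simps)
    finally have "?h x (raise y) + ?h (raise x) y =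
        (\<Sum>\<nu>\<in>UNIV. \<Sum>\<mu>\<in>UNIV. ?h x (\<nu>, 0) * mconst (ginv \<mu> \<nu>) * ?h (\<mu>, 0) y)"
      by (simp only: hess_at_sym[of F f x "raise y"] hess_at_sym[of F f "raise x" y])
    from this[symmetric] show ?thesis by (simp only:) simp
  qed
  have "msum (\<lambda>y. ?h x y * q_coord (zmult v) y) =
      (\<Sum>\<nu>\<in>UNIV. ?h x (\<nu>, 0) * q_coord (zmult v) (\<nu>, 0)) + msum (\<lambda>y. ?h x (raise y) * ?q y)"
    by (subst msum_raise) (simp_all add: q_coord_zmult_raise locfin_mult locfin_q_coord zmult_in_families v)
  also have "(\<Sum>\<nu>\<in>UNIV. ?h x (\<nu>, 0) * q_coord (zmult v) (\<nu>, 0)) =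
      - (\<Sum>\<nu>\<in>UNIV. \<Sum>\<mu>\<in>UNIV. ?h x (\<nu>, 0) * mconst (ginv \<mu> \<nu>) * msum (\<lambda>y. ?h (\<mu>, 0) y * ?q y))"
    by (simp add: q_coord_zmult_0 p sum_distrib_left sum_negf mult.assoc)
  also have "\<dots> = - msum (\<lambda>y. (\<Sum>\<nu>\<in>UNIV. \<Sum>\<mu>\<in>UNIV. ?h x (\<nu>, 0) * mconst (ginv \<mu> \<nu>) * ?h (\<mu>, 0) y) * ?q y)"
    unfolding sum_distrib_right mult.assoc
    by (simp add: msum_sum locfin_sum locfin_mult lf msum_mult_left)
  also have "\<dots> + msum (\<lambda>y. ?h x (raise y) * ?q y) =
      msum (\<lambda>y. ?h x (raise y) * ?q y - (\<Sum>\<nu>\<in>UNIV. \<Sum>\<mu>\<in>UNIV. ?h x (\<nu>, 0) * mconst (ginv \<mu> \<nu>) * ?h (\<mu>, 0) y) * ?q y)"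
    by (simp add: msum_diff locfin_mult lf)
  also have "\<dots> = msum (\<lambda>y. - (?h (raise x) y * ?q y))"
    by (simp only: left_diff_distrib[symmetric] tp mult_minus_left)
  also have "\<dots> = p_coord (zmult v) x"
    by (simp add: msum_minus p_coord_zmult p)
  finally show "p_coord (zmult v) x = msum (\<lambda>y. ?h x y * q_coord (zmult v) y)" ..
qed

text \<open>The candidate is \<open>f\<close> divided by z; its tangency at level 0 and at the
  higher levels is given by the two parts of \<open>string_at\<close>.\<close>

lemma germ_in_zmult_tangent:
  assumes "string F = 0" "f \<in> germ F"
  shows "f \<in> zmult ` tangent F f"
proof -
  have f: "based f" "\<And>x. p_coord f x = msubst (pd x F) (t_coord f)"
    using germ_based[OF assms(2)] p_coord_germ[OF assms(2)] by auto
  then obtain w where w: "w \<in> families" "zmult w = f" by (auto simp: based_def elim: zmult_surj)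
  have q: "q_coord f (raise y) = q_coord w y" for y
    using q_coord_zmult_raise[of w y] w by simp
  have "p_coord w x = msum (\<lambda>y. hess_at F f x y * q_coord w y)" for x
  proof (cases x rule: coord_cases)
    case (zero \<alpha>)
    show ?thesis
      unfolding zero p_coord_0_of_zmult w
      using string_at(1)[OF assms(1) f(1), of \<alpha>] by (simp add: q add_eq_0_iff)
  next
    case (raise y)
    have "p_coord w (raise y) = - p_coord f y" using p_coord_zmult[of w y] w by simp
    then show ?thesis
      unfolding raise using string_at(2)[OF assms(1) f(1), of y] by (simp add: q f(2) add_eq_0_iff)
  qed
  then have "w \<in> tangent F f" using w by (simp add: tangent_iff)
  then show ?thesis using w by blast
qed

lemma admissible_line:
  assumes "admissible x" "admissible r"
  shows "admissible (\<lambda>i. x i + mconst \<tau> * r i)"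
  using assms by (auto simp: admissible_def intro: locfin_add locfin_mult)

text \<open>
  Along the segment from \<open>f\<close> to a point \<open>g\<close> of \<open>z T\<close>, where \<open>T\<close> is the tangent space at \<open>f\<close>,
  the topological recursion relation turns the derivative of the Hessian into an expression that is
  linear in the change of the Hessian, with coefficients vanishing at \<open>s = 0\<close>. So this change
  vanishes, by induction on the degree of its coefficients.
\<close>

lemma hess_at_zmult_tangent:
  assumes trr: "TRR F" and f: "based f" and v: "v \<in> tangent F f"
    and w: "w \<in> tangent F f" "zmult w = f" and g: "zmult v 0 = f 0"
  shows "hess_at F (zmult v) = hess_at F f"
proof -
  define r where "r x = q_coord (zmult v) x - q_coord f x" for x
  define d where "d x = q_coord v x - q_coord w x" for x
  define t where "t \<tau> = (\<lambda>x. t_coord f x + mconst \<tau> * r x)" for \<tau>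
  define D where "D \<tau> x y = msubst (hess F x y) (t \<tau>) - hess_at F f x y" for \<tau> x y
  have fam: "v \<in> families" "w \<in> families" "f \<in> families" "zmult v \<in> families"
    using v w f by (auto simp: tangent_iff based_def zmult_in_families)
  have r_raise: "r (raise x) = d x" for x
    by (simp add: r_def d_def q_coord_zmult_raise flip: w(2))
  have lf: "locfin d" "locfin r"
    unfolding d_def r_def by (auto intro!: locfin_diff locfin_q_coord fam)
  have r0: "mcoeff (r x) 0 = 0" for x
    using g by (cases x) (simp add: r_def mcoeff_q_coord)
  then have d0: "mcoeff (d x) 0 = 0" for x by (simp flip: r_raise)
  have r: "admissible r" using lf r0 by (simp add: admissible_def)
  have adm: "admissible (t \<tau>)" for \<tau>
    unfolding t_def by (intro admissible_line admissible_t_coord f r)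
  have r_0: "r (\<nu>, 0) = - (\<Sum>\<mu>\<in>UNIV. mconst (ginv \<mu> \<nu>) * msum (\<lambda>y. hess_at F f y (\<mu>, 0) * d y))" for \<nu>
  proof -
    have "msum (\<lambda>y. hess_at F f y (\<mu>, 0) * d y) = p_coord v (\<mu>, 0) - p_coord w (\<mu>, 0)" for \<mu>
      using v w unfolding d_def right_diff_distrib
      by (subst msum_diff) (auto simp: tangent_iff hess_at_sym[of F f _ "(\<mu>, 0)"] intro!: locfin_mult locfin_q_coord)
    then show ?thesis
      by (simp add: r_def q_coord_zmult_0 sum_subtractf right_diff_distrib flip: w(2))
  qed
  \<comment> \<open>If \<open>r\<close> were z times a vector tangent at \<open>t \<tau>\<close>,
    the recursion would make its level-0 part cancel the rest. It is z times a vector tangent at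
    \<open>f\<close>, so the change \<open>D\<close> of the Hessian remains.\<close>
  have step: "msum (\<lambda>z. msubst (pd z (hess F x y)) (t \<tau>) * r z) =
     (\<Sum>\<mu>\<in>UNIV. \<Sum>\<nu>\<in>UNIV. mconst (ginv \<mu> \<nu>) * msubst (pd (\<nu>, 0) (hess F x y)) (t \<tau>) *
       msum (\<lambda>z. D \<tau> z (\<mu>, 0) * d z))" for x y \<tau>
  proof -
    let ?T = "\<lambda>\<nu>. msubst (pd (\<nu>, 0) (hess F x y)) (t \<tau>)"
    let ?H = "\<lambda>\<mu>. msum (\<lambda>z. msubst (hess F z (\<mu>, 0)) (t \<tau>) * d z)"
    let ?h = "\<lambda>\<mu>. msum (\<lambda>z. hess_at F f z (\<mu>, 0) * d z)"
    have T: "msubst (pd (raise z) (hess F x y)) (t \<tau>) * d z =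
        (\<Sum>\<mu>\<in>UNIV. \<Sum>\<nu>\<in>UNIV. mconst (ginv \<mu> \<nu>) * ?T \<nu> * (msubst (hess F z (\<mu>, 0)) (t \<tau>) * d z))" for z
    proof -
      have "pd (raise z) (hess F x y) = (\<Sum>\<mu>\<in>UNIV. \<Sum>\<nu>\<in>UNIV. hess F z (\<mu>, 0) * mconst (ginv \<mu> \<nu>) * pd (\<nu>, 0) (hess F x y))"
        using trr unfolding TRR_iff by blast
      then show ?thesis
        by (simp only: msubst_sum[OF adm] msubst_mult[OF adm] msubst_mconst sum_distrib_right
            sum_distrib_left ac_simps)
    qed
    have "msum (\<lambda>z. msubst (pd z (hess F x y)) (t \<tau>) * r z) =
        (\<Sum>\<nu>\<in>UNIV. ?T \<nu> * r (\<nu>, 0)) + msum (\<lambda>z. msubst (pd (raise z) (hess F x y)) (t \<tau>) * d z)"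
      by (subst msum_raise) (simp_all add: r_raise locfin_mult lf)
    also have "msum (\<lambda>z. msubst (pd (raise z) (hess F x y)) (t \<tau>) * d z) =
        (\<Sum>\<mu>\<in>UNIV. \<Sum>\<nu>\<in>UNIV. mconst (ginv \<mu> \<nu>) * ?T \<nu> * ?H \<mu>)"
      unfolding T by (simp add: msum_sum locfin_sum locfin_mult lf msum_mult_left)
    also have "(\<Sum>\<nu>\<in>UNIV. ?T \<nu> * r (\<nu>, 0)) = - (\<Sum>\<nu>\<in>UNIV. \<Sum>\<mu>\<in>UNIV. mconst (ginv \<mu> \<nu>) * ?T \<nu> * ?h \<mu>)"
      unfolding r_0 mult_minus_right sum_negf sum_distrib_left by (simp only: ac_simps)
    also have "(\<Sum>\<nu>\<in>UNIV. \<Sum>\<mu>\<in>UNIV. mconst (ginv \<mu> \<nu>) * ?T \<nu> * ?h \<mu>) =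
        (\<Sum>\<mu>\<in>UNIV. \<Sum>\<nu>\<in>UNIV. mconst (ginv \<mu> \<nu>) * ?T \<nu> * ?h \<mu>)"
      by (rule sum.swap)
    also have "- \<dots> + (\<Sum>\<mu>\<in>UNIV. \<Sum>\<nu>\<in>UNIV. mconst (ginv \<mu> \<nu>) * ?T \<nu> * ?H \<mu>) =
        (\<Sum>\<mu>\<in>UNIV. \<Sum>\<nu>\<in>UNIV. mconst (ginv \<mu> \<nu>) * ?T \<nu> * (?H \<mu> - ?h \<mu>))"
      by (simp add: right_diff_distrib sum_subtractf)
    also have "\<dots> = (\<Sum>\<mu>\<in>UNIV. \<Sum>\<nu>\<in>UNIV. mconst (ginv \<mu> \<nu>) * ?T \<nu> * msum (\<lambda>z. D \<tau> z (\<mu>, 0) * d z))"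
      by (simp add: D_def left_diff_distrib msum_diff locfin_mult lf)
    finally show ?thesis .
  qed
  have deriv: "mderiv (\<lambda>\<tau>. D \<tau> x y) (\<lambda>\<tau>. msum (\<lambda>z. msubst (pd z (hess F x y)) (t \<tau>) * r z))" for x y
    using mderiv_diff[OF mderiv_msubst[OF admissible_t_coord[OF f] r, of "hess F x y"]
        mderiv_const[of "hess_at F f x y"]]
    by (simp add: D_def t_def)
  have D0: "D 0 x y = 0" for x y
    by (simp add: D_def t_def hess_at_def)
  have D: "mcoeff (D \<tau> x y) m = 0" for \<tau> x y m
  \<comment> \<open>\<tau> has to be arbitrary: a coefficient is constant along the line once its
    derivative vanishes at every \<tau>, and this uses the lower coefficients of \<open>D\<close> at
    every \<tau>.\<close>
  proof (induction "mdeg m" arbitrary: \<tau> x y m rule: less_induct)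
    case less
    have Dd: "mcoeff (msum (\<lambda>z. D \<tau> z (\<mu>, 0) * d z)) b = 0" if "a + b = m" for \<tau> \<mu> a b
    proof -
      have "mcoeff (D \<tau> z (\<mu>, 0) * d z) b = 0" for z
      proof (rule ccontr)
        assume "mcoeff (D \<tau> z (\<mu>, 0) * d z) b \<noteq> 0"
        then obtain k l where kl: "k + l = b" "mcoeff (D \<tau> z (\<mu>, 0)) k \<noteq> 0" "mcoeff (d z) l \<noteq> 0"
          by (rule mcoeff_mult_nonzero)
        have "l \<noteq> 0" using d0[of z] kl(3) by auto
        then have "mdeg l > 0" by (simp flip: neq0_conv)
        then have "mdeg k < mdeg m" using kl(1) that by auto
        then show False using less kl(2) by blast
      qed
      then show ?thesis by (simp add: mcoeff_msum)
    qed
    have Xd: "mcoeff (X * msum (\<lambda>z. D \<tau> z (\<mu>, 0) * d z)) m = 0" for X \<tau> \<mu>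
      unfolding mcoeff_mult by (rule sum.neutral) (auto simp: Dd)
    have 0: "mcoeff (msum (\<lambda>z. msubst (pd z (hess F x y)) (t \<tau>) * r z)) m = 0" for \<tau>
      by (simp add: step mcoeff_sum Xd)
    have "((\<lambda>\<tau>. mcoeff (D \<tau> x y) m) has_field_derivative 0) (at \<tau>)" for \<tau>
      using deriv[of x y, unfolded mderiv_def, rule_format, of m \<tau>] by (simp only: 0)
    then have "mcoeff (D \<tau> x y) m = mcoeff (D 0 x y) m"
      by (rule mderiv_zero_imp_const)
    then show ?case by (simp add: D0)
  qed
  have "t 1 = t_coord (zmult v)"
    by (auto simp: t_def r_def t_coord_def)
  moreover have "D 1 x y = 0" for x y
    by (rule mfps_eqI) (simp add: D)
  ultimately show ?thesis
    by (intro ext) (simp add: D_def hess_at_def)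
qed

text \<open>The Hessian at \<open>zmult v\<close> is that at \<open>f\<close>, so the second part of
  \<open>string_at\<close>, applied at \<open>zmult v\<close>, expresses dF there through the
  p-coordinates of \<open>v\<close> at raised indices, which up to sign are those of z v.\<close>

lemma zmult_tangent_in_germ:
  assumes "TRR F" "string F = 0" "f \<in> germ F" "v \<in> tangent F f" "zmult v 0 = f 0"
  shows "zmult v \<in> germ F" "tangent F (zmult v) = tangent F f"
proof -
  have f: "based f" using assms(3) by (simp add: germ_iff)
  obtain w where w: "w \<in> tangent F f" "zmult w = f"
    using germ_in_zmult_tangent[OF assms(2,3)] by blast
  have h: "hess_at F (zmult v) = hess_at F f"
    by (rule hess_at_zmult_tangent[OF assms(1) f assms(4) w assms(5)])
  then show "tangent F (zmult v) = tangent F f"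
    by (auto simp: tangent_iff)
  have g: "based (zmult v)"
    using f assms(4,5) by (auto simp: based_def tangent_iff zmult_in_families)
  have "p_coord (zmult v) x = msubst (pd x F) (t_coord (zmult v))" for x
    using string_at(2)[OF assms(2) g, of x] assms(4)
    by (simp add: h p_coord_zmult p_coord_tangent[OF assms(4)] q_coord_zmult_raise add_eq_0_iff)
  with g show "zmult v \<in> germ F" by (simp add: germ_iff)
qed

lemma scale_family_at_0: "mcoeff c 0 = 1 \<Longrightarrow> scale_family c f 0 = f 0"
  by (simp add: scale_family_def)

lemma geometry_of_equations:
  assumes "TRR F" "SE F" "DE F"
  shows "Lagrangian_cone F" "tangent_exactly_along_zL F" "normalized F"
proof -
  have str: "string F = 0" using assms(2) by (simp add: SE_iff_string)
  show "tangent_exactly_along_zL F"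
    unfolding tangent_exactly_along_zL_def
  proof (intro ballI conjI impI)
    fix f :: "('n \<times> nat, 'h) family" assume f: "f \<in> germ F"
    show "zmult ` tangent F f \<subseteq> tangent F f"
      using zmult_tangent[OF assms(1) str germ_based[OF f]] by blast
    show "f \<in> zmult ` tangent F f" by (rule germ_in_zmult_tangent[OF str f])
    fix g assume "g \<in> zmult ` tangent F f" "g 0 = f 0"
    then show "g \<in> germ F" "tangent F g = tangent F f"
      using zmult_tangent_in_germ[OF assms(1) str f] by blast+
  qed
  have "scale_family c f \<in> germ F" if f: "f \<in> germ F" and c: "mcoeff c 0 = 1"
    for f :: "('n \<times> nat, 'h) family" and c
  proof -
    \<comment> \<open>The multiple of \<open>f\<close> = z w by \<open>c\<close> is z times the
      multiple of \<open>w\<close>, hence a point of z T; the constant term 1 of \<open>c\<close>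
      keeps the base point.\<close>
    obtain w where w: "w \<in> tangent F f" "f = zmult w"
      using germ_in_zmult_tangent[OF str f] by blast
    then have "zmult (scale_family c w) \<in> germ F"
      using c by (intro zmult_tangent_in_germ[OF assms(1) str f])
        (auto simp: scale_family_in_tangent zmult_scale_family scale_family_at_0)
    then show ?thesis by (simp add: zmult_scale_family w(2))
  qed
  then show "Lagrangian_cone F"
    by (simp add: Lagrangian_cone_def Lagrangian_tangent)
  have "mcoeff (euler F) 0 = 0" using assms(3) by (simp add: DE_iff_euler)
  then show "normalized F"
    by (simp add: normalized_def euler_def mcoeff_msum_qvar_0 mcoeff_two_mult) (metis minus_minus)
qed

section \<open>Identities of power series read off at the tautological family\<close>

section \<open>From the geometry to the equations\<close>

text \<open>The universal family: its parameters are the coordinates t themselves, so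
  \<open>t_coord\<close> is the identity substitution.\<close>

definition tautological :: "('n \<times> nat) mfps \<Rightarrow> ('n \<times> nat, 'h) family"
  where "tautological F = mk_family qvar (\<lambda>x. pd x F)"

lemma t_coord_tautological [simp]: "t_coord (tautological F) = mvar"
  by (auto simp: t_coord_def tautological_def qvar_def)

lemma hess_at_tautological [simp]: "hess_at F (tautological F) x y = hess F x y"
  by (simp add: hess_at_def)

lemma tautological_in_germ: "tautological F \<in> germ F"
proof -
  have "tautological F 0 i = loop_monom (- unit) 1 i" if i: "i \<ge> 0" for i
  proof (rule eq_if_rep_eq)
    fix \<alpha>
    from i obtain k where "i = int k" by (rule nonneg_int_cases)
    moreover have "rep (tautological F 0 (int k)) \<alpha> = mcoeff (qvar (\<alpha>, k)) 0"
      using mcoeff_q_coord[of "tautological F" \<alpha> k 0] by (simp add: tautological_def)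
    ultimately show "rep (tautological F 0 i) \<alpha> = rep (loop_monom (- unit) 1 i) \<alpha>"
      by (simp add: rep_base_point mcoeff_qvar_0)
  qed
  moreover have "tautological F \<in> families"
    by (simp add: tautological_def locfin_qvar)
  ultimately have "based (tautological F)" by (simp add: based_def)
  then show ?thesis unfolding germ_iff t_coord_tautological by (simp add: tautological_def)
qed

lemma admissible_mvar_mult: "locfin r \<Longrightarrow> admissible (\<lambda>x. mvar i * r x)"
  by (simp add: admissible_def locfin_mult mcoeff_mult_0 mcoeff_mvar)

text \<open>
  The base point is fixed, so only displacements vanishing at \<open>s = 0\<close> are available; the factor
  \<open>mvar i\<close> arranges for that and can be cancelled afterwards.
\<close>

lemma derivative_along:
  assumes "locfin r"
    and eq: "\<And>\<tau>. msubst G (\<lambda>x. mvar x + mconst \<tau> * (mvar i * r x)) = G + mconst \<tau> * (mvar i * G')"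
  shows "msum (\<lambda>x. pd x G * r x) = G'"
proof -
  let ?D = "\<lambda>\<tau>. msum (\<lambda>x. msubst (pd x G) (\<lambda>x. mvar x + mconst \<tau> * (mvar i * r x)) * (mvar i * r x))"
  have "mderiv (\<lambda>\<tau>. msubst G (\<lambda>x. mvar x + mconst \<tau> * (mvar i * r x))) ?D"
    by (rule mderiv_msubst[OF admissible_mvar admissible_mvar_mult[OF assms(1)]])
  moreover have "mderiv (\<lambda>\<tau>. msubst G (\<lambda>x. mvar x + mconst \<tau> * (mvar i * r x))) (\<lambda>_. mvar i * G')"
    unfolding eq by (rule mderiv_line)
  ultimately have "?D 0 = mvar i * G'"
    by (rule mderiv_unique)
  then have "msum (\<lambda>x. mvar i * (pd x G * r x)) = mvar i * G'"
    by (simp add: mult.left_commute)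
  then have "mvar i * (msum (\<lambda>x. pd x G * r x) - G') = 0"
    by (simp add: msum_mult_left locfin_mult assms(1) right_diff_distrib)
  then show ?thesis using mvar_mult_eq_0 by fastforce
qed

text \<open>Scaling by \<open>1 + \<tau>\<close> times a parameter keeps the base point and
  multiplies q and dF by the same factor, which exhibits dF as homogeneous of degree 1. The choice
  of the parameter \<open>(e, 0)\<close> is arbitrary.\<close>

lemma pd_euler_of_cone:
  assumes "Lagrangian_cone F"
  shows "pd x (euler F) = 0"
proof -
  let ?f = "tautological F" and ?i = "(e, 0)"
  have "msum (\<lambda>y. pd y (pd x F) * qvar y) = pd x F"
  proof (rule derivative_along[OF locfin_qvar])
    fix \<tau>
    let ?c = "1 + mconst \<tau> * mvar ?i"
    have "mcoeff ?c 0 = 1" by (simp add: mcoeff_one mcoeff_mvar)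
    then have "scale_family ?c ?f \<in> germ F"
      using assms tautological_in_germ unfolding Lagrangian_cone_def by blast
    from p_coord_germ[OF this, of x]
    have "?c * pd x F = msubst (pd x F) (t_coord (scale_family ?c ?f))"
      unfolding p_coord_scale_family by (simp add: tautological_def)
    moreover have "t_coord (scale_family ?c ?f) = (\<lambda>y. mvar y + mconst \<tau> * (mvar ?i * qvar y))"
      by (rule ext) (simp add: t_coord_def q_coord_scale_family tautological_def distrib_right mult.assoc,
          simp add: qvar_def)
    ultimately show "msubst (pd x F) (\<lambda>y. mvar y + mconst \<tau> * (mvar ?i * qvar y)) =
        pd x F + mconst \<tau> * (mvar ?i * pd x F)"
      by (simp add: distrib_right mult.assoc)
  qed
  then show ?thesis
    by (simp add: pd_euler mult.commute pd_commute[of x])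
qed

lemma euler_of_cone:
  assumes "Lagrangian_cone F" "normalized F"
  shows "euler F = 0"
proof -
  have "euler F = mconst (mcoeff (euler F) 0)"
    by (rule eq_mconst_if_pd_eq_0) (rule pd_euler_of_cone[OF assms(1)])
  also have "mcoeff (euler F) 0 = 0"
    using assms(2) by (simp add: normalized_def euler_def mcoeff_msum_qvar_0 mcoeff_two_mult)
  finally show ?thesis by simp
qed

lemma tangent_exactly_along_zLD:
  fixes f :: "('n \<times> nat, 'h) family"
  assumes "tangent_exactly_along_zL F" "f \<in> germ F"
  shows "f \<in> zmult ` tangent F f"
    and "v \<in> tangent F f \<Longrightarrow> zmult v 0 = f 0 \<Longrightarrow> tangent F (zmult v) = tangent F f"
  using bspec[OF assms(1)[unfolded tangent_exactly_along_zL_def] assms(2)] by blast+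

text \<open>The tautological family is z w with \<open>w\<close> tangent. The p-coordinates of
  \<open>w\<close> come from the Hessian on the one hand and from the coordinates of z w on the
  other; both kinds of derivatives result from comparing them.\<close>

lemma pd_string_of_cone:
  assumes "tangent_exactly_along_zL F"
  shows "pd x (string F) = 0"
proof -
  let ?f = "tautological F"
  from tangent_exactly_along_zLD(1)[OF assms tautological_in_germ]
  obtain w where w0: "?f = zmult w" "w \<in> tangent F ?f" by (rule imageE)
  note w = w0(2) w0(1)[symmetric]
  have q: "q_coord w y = qvar (raise y)" for y
    using q_coord_zmult_raise[of w y] w(2) by (simp add: tautological_def)
  have p: "p_coord w y = msum (\<lambda>z. qvar (raise z) * hess F y z)" for y
    unfolding p_coord_tangent[OF w(1)] by (simp add: q mult.commute)
  show ?thesis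
  proof (cases x rule: coord_cases)
    case (zero \<alpha>)
    have "p_coord w (\<alpha>, 0) = - (\<Sum>\<beta>\<in>UNIV. mconst (gram $ \<alpha> $ \<beta>) * mvar (\<beta>, 0))"
      unfolding p_coord_0_of_zmult w(2) by (simp add: tautological_def)
    then show ?thesis by (simp add: zero pd_string_0 flip: p)
  next
    case (raise y)
    have "p_coord w (raise y) = - pd y F"
      using p_coord_zmult[of w y] w(2) by (simp add: tautological_def)
    then show ?thesis by (simp add: raise pd_string_raise flip: p)
  qed
qed

lemma string_of_cone:
  assumes "Lagrangian_cone F" "tangent_exactly_along_zL F"
  shows "string F = 0"
proof -
  let ?a = "mcoeff (pd (e, 0) F) 0" and ?b = "mcoeff (hess F (e, 1) (e, 0)) 0"
  \<comment> \<open>At the origin only the q-coordinate at \<open>(e, 1)\<close>, equal to -1,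
    survives in either differential; the constant term of \<open>string F\<close> is
    \<open>- ?a\<close> for the same reason.\<close>
  have "mcoeff (pd (e, 0) (euler F)) 0 = 0" "mcoeff (pd (raise (e, 0)) (string F)) 0 = 0"
    using pd_euler_of_cone[OF assms(1)] pd_string_of_cone[OF assms(2)] by simp_all
  then have "- ?b - ?a = 0" "?a - ?b = 0"
    unfolding pd_euler pd_string_raise mcoeff_simps mcoeff_msum_qvar_0 mcoeff_msum_qvar_raise_0
    by (simp_all add: pd_commute[of "(e, 0)" "(e, 1)"] pd_commute[of "(e, 0)" "(e, Suc 0)"])
  then have "?a = 0" by auto
  have "string F = mconst (mcoeff (string F) 0)"
    by (rule eq_mconst_if_pd_eq_0) (rule pd_string_of_cone[OF assms(2)])
  also have "mcoeff (string F) 0 = 0"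
    using \<open>?a = 0\<close> by (simp add: string_def mcoeff_msum_qvar_raise_0 mcoeff_sum mcoeff_mult_0 mcoeff_mvar)
  finally show ?thesis by simp
qed

text \<open>The Hessian is constant along z times the tangent vector over \<open>x\<close>. This
  direction has entry 1 at \<open>raise x\<close>, 0 at the other raised indices, and at level 0 the
  Hessian entries of \<open>x\<close> with level 0, transformed by minus the inverse Gram matrix;
  the vanishing derivative is the recursion.\<close>

lemma TRR_of_cone:
  assumes "tangent_exactly_along_zL F"
  shows "TRR F"
  unfolding TRR_iff
proof (intro allI)
  fix x y z
  let ?f = "tautological F" and ?i = "(e, 0)"
  let ?v = "tangent_basis F ?f x"
  let ?r = "q_coord (zmult ?v)"
  have v: "?v \<in> tangent F ?f" by (rule tangent_basis_in_tangent)
  then have lf: "locfin ?r" by (intro locfin_q_coord zmult_in_families) (simp add: tangent_iff)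
  from tangent_exactly_along_zLD(1)[OF assms tautological_in_germ]
  obtain w where w0: "?f = zmult w" "w \<in> tangent F ?f" by (rule imageE)
  note w = w0(2) w0(1)[symmetric]
  have "msum (\<lambda>u. pd u (hess F y z) * ?r u) = 0"
  proof (rule derivative_along[OF lf])
    fix \<tau>
    let ?b = "mconst \<tau> * mvar ?i"
    \<comment> \<open>Chosen so that \<open>zmult w'\<close> is the tautological family displaced by
      \<open>?b\<close> times \<open>zmult ?v\<close>; since \<open>?b\<close> vanishes at s = 0,
      the base point is kept.\<close>
    define w' where "w' = mk_family (\<lambda>x. 1 * q_coord w x + ?b * q_coord ?v x)
      (\<lambda>x. 1 * p_coord w x + ?b * p_coord ?v x)"
    have w': "w' \<in> tangent F ?f"
      unfolding w'_def by (rule combination_in_tangent[OF w(1) v])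
    have q: "q_coord (zmult w') u = q_coord ?f u + ?b * ?r u"
      and p: "p_coord (zmult w') u = p_coord ?f u + ?b * p_coord (zmult ?v) u" for u
      unfolding w'_def zmult_combination by (simp_all add: w(2))
    have "zmult w' 0 = ?f 0"
      by (rule family_eqI_at) (simp_all add: q p mcoeff_mult_0 mcoeff_mvar mult.assoc)
    then have "tangent F (zmult w') = tangent F ?f"
      by (rule tangent_exactly_along_zLD(2)[OF assms tautological_in_germ w'])
    \<comment> \<open>Equality of tangent spaces becomes equality of Hessians: this vector lies in
      both, and its p-coordinates are column \<open>z\<close> of either.\<close>
    then have "tangent_basis F ?f z \<in> tangent F (zmult w')"
      using tangent_basis_in_tangent by simp
    from p_coord_tangent[OF this, of y] have "hess_at F (zmult w') y z = hess F y z"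
      by (simp add: tangent_basis_def msum_mult_delta)
    moreover have "t_coord (zmult w') = (\<lambda>u. mvar u + mconst \<tau> * (mvar ?i * ?r u))"
      by (rule ext) (simp add: t_coord_def q tautological_def qvar_def mult.assoc)
    ultimately show "msubst (hess F y z) (\<lambda>u. mvar u + mconst \<tau> * (mvar ?i * ?r u)) =
        hess F y z + mconst \<tau> * (mvar ?i * 0)"
      by (simp add: hess_at_def)
  qed
  moreover have "msum (\<lambda>u. pd u (hess F y z) * ?r u) =
      (\<Sum>\<nu>\<in>UNIV. pd (\<nu>, 0) (hess F y z) * ?r (\<nu>, 0)) + pd (raise x) (hess F y z)"
    by (subst msum_raise[OF locfin_mult[OF lf]])
      (simp add: q_coord_zmult_raise tangent_basis_def msum_mult_delta)
  moreover have "(\<Sum>\<nu>\<in>UNIV. pd (\<nu>, 0) (hess F y z) * ?r (\<nu>, 0)) =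
      - (\<Sum>\<nu>\<in>UNIV. \<Sum>\<mu>\<in>UNIV. hess F x (\<mu>, 0) * mconst (ginv \<mu> \<nu>) * pd (\<nu>, 0) (hess F y z))"
    unfolding q_coord_zmult_0 mult_minus_right sum_negf sum_distrib_left
    by (simp add: tangent_basis_def pd_commute[of x "(_, 0)"] ac_simps)
  moreover have "(\<Sum>\<nu>\<in>UNIV. \<Sum>\<mu>\<in>UNIV. hess F x (\<mu>, 0) * mconst (ginv \<mu> \<nu>) * pd (\<nu>, 0) (hess F y z)) =
      (\<Sum>\<mu>\<in>UNIV. \<Sum>\<nu>\<in>UNIV. hess F x (\<mu>, 0) * mconst (ginv \<mu> \<nu>) * pd (\<nu>, 0) (hess F y z))"
    by (rule sum.swap)
  ultimately show "pd (raise x) (hess F y z) =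
      (\<Sum>\<mu>\<in>UNIV. \<Sum>\<nu>\<in>UNIV. hess F x (\<mu>, 0) * mconst (ginv \<mu> \<nu>) * pd (\<nu>, 0) (hess F y z))"
    by (simp add: neg_eq_iff_add_eq_0)
qed

end

theorem theorem1:
  fixes scale :: "complex \<Rightarrow> 'h::ab_group_add \<Rightarrow> 'h"
    and pair :: "'h \<Rightarrow> 'h \<Rightarrow> complex"
    and unit :: 'h
    and \<phi> :: "'n::finite \<Rightarrow> 'h"
    and e :: 'n
    and F :: "('n \<times> nat) mfps"
  assumes "pairing_space scale pair unit \<phi> e"
  shows "(pairing_space.TRR pair \<phi> F \<and> pairing_space.SE pair \<phi> e F \<and> pairing_space.DE e F) \<longleftrightarrow>
    (pairing_space.Lagrangian_cone scale pair unit \<phi> e F \<and>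
     pairing_space.tangent_exactly_along_zL scale pair unit \<phi> e F \<and>
     pairing_space.normalized e F)"
proof -
  interpret pairing_space scale pair unit \<phi> e by fact
  show ?thesis
    using geometry_of_equations[of F] TRR_of_cone[of F] string_of_cone[of F] euler_of_cone[of F]
    by (auto simp: SE_iff_string DE_iff_euler)
qed

end
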